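(* Let $r\ge 0$ be an integer and let $K$ be the Fredholm integral operator $(Kx)(s)=\int_0^1\kappa(s,t)x(t)\,dt$ with a Green's function type kernel $\kappa$. Assume $1$ is not an eigenvalue of $K$, let $f\in C[0,1]$, and suppose that the unique solution $\phi$ of $\phi-K\phi=f$ satisfies $\phi\in C^{2r+2}([0,1])$. Let $P_n$ be the interpolatory projection onto $X_n$ at the collocation points $\tau_j^k$. For all sufficiently large $n$, let $\phi_n^C$ be the unique solution of the collocation equation $\phi_n^C-P_nK\phi_n^C=P_nf$, and let $\phi_n^S=K\phi_n^C+f$ be the iterated collocation solution. Then, as $n\to\infty$ with $h=1/n$, $$\|\phi-\phi_n^C\|_\infty=O(h^{2r+1}),\qquad \|\phi-\phi_n^S\|_\infty=O(h^{2r+2}).$$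
   Context: Kernel: $\Omega_1=\{(s,t):0\le t\le s\le 1\}$, $\Omega_2=\{(s,t):0\le s\le t\le 1\}$. A continuous function $\kappa:[0,1]\times[0,1]\to\mathbb{R}$ is of Green's function type if there are $\kappa_i\in C^\alpha(\Omega_i)$, $i=1,2$, with $\kappa=\kappa_1$ on $\Omega_1$, $\kappa=\kappa_2$ on $\Omega_2$, and $\kappa_1(s,s)=\kappa_2(s,s)$ for all $s\in[0,1]$. Here $\alpha$ is a positive integer with $\alpha>r$ when $r\ge1$, and it is assumed throughout that the partial derivatives $D^{(j,k)}\kappa_i=\partial^{j+k}\kappa_i/\partial s^j\partial t^k$, $j,k\in\{0,1,2\}$, exist and are continuous and bounded on $\Omega_i$. The formula for $K$ is used on $C[0,1]$ and also on $L^\infty[0,1]$. Approximation: for $n\ge1$ let $h=1/n$, $t_j=j/n$ ($0\le j\le n$), $\Delta_j=[t_{j-1},t_j]$, and let $X_n$ be the set of $x\in L^\infty[0,1]$ such that $x|_{\Delta_j}$ is a polynomial of degree $\le 2r$ for each $j=1,\dots,n$. The collocation points in $\Delta_j$ are $\tau_j^k=t_{j-1}+\frac{kh}{2r}$, $k=0,1,\dots,2r$, if $r\ge1$; if $r=0$ the single collocation point is the midpoint $\tau_j^0=\frac{t_{j-1}+t_j}{2}$. For $x\in C[0,1]$, $P_nx\in X_n$ is the function whose restriction to each $\Delta_j$ is the polynomial of degree $\le 2r$ interpolating $x$ at $\tau_j^0,\dots,\tau_j^{2r}$. Via the Hahn-Banach theorem, $P_n$ is extended to a projection $P_n:L^\infty[0,1]\to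 X_n$, with $\|P_n\|$ bounded uniformly in $n$. $\|\cdot\|_\infty$ is the sup norm on $[0,1]$. Constants in $O(\cdot)$ are independent of $h$. *)

theory Defs
  imports
    "HOL-Analysis.Analysis"
    "HOL-Probability.Essential_Supremum"
    "HOL-Library.Landau_Symbols"
    "HOL-Computational_Algebra.Polynomial"
begin

section \<open>The space $L^\infty[0,1]$\<close>

text \<open>
  Elements of $L^\infty[0,1]$ are represented by functions \<^typ>\<open>real \<Rightarrow> real\<close>; equality
  in $L^\infty[0,1]$ is equality almost everywhere on $[0,1]$.
\<close>

abbreviation unit_lebesgue :: "real measure" where
  "unit_lebesgue \<equiv> lebesgue_on {0..1}"

definition Linf :: "(real \<Rightarrow> real) set" where
  "Linf = {x \<in> borel_measurable unit_lebesgue.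
             esssup unit_lebesgue (\<lambda>t. ereal \<bar>x t\<bar>) < \<infinity>}"

text \<open>Only meaningful on \<^term>\<open>Linf\<close>: elsewhere \<^const>\<open>real_of_ereal\<close> returns 0.\<close>

definition Linf_norm :: "(real \<Rightarrow> real) \<Rightarrow> real" where
  "Linf_norm x = real_of_ereal (esssup unit_lebesgue (\<lambda>t. ereal \<bar>x t\<bar>))"

lemma AE_bound_imp_bound:
  fixes x :: "real \<Rightarrow> real"
  assumes "continuous_on {0..1} x" and "AE t in unit_lebesgue. \<bar>x t\<bar> \<le> c" and "t \<in> {0..1}"
  shows "\<bar>x t\<bar> \<le> c"
proof -
  let ?C = "{t \<in> {0..1}. \<bar>x t\<bar> \<le> c}"
  have cl: "closed ?C"
    by (intro continuous_on_closed_Collect_le continuous_intros assms(1))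
  have ae: "AE t in lebesgue. t \<in> {0<..<1} \<longrightarrow> t \<in> ?C"
  proof -
    have "AE t in lebesgue. t \<in> {0..1} \<longrightarrow> \<bar>x t\<bar> \<le> c"
      using assms(2) by (simp add: AE_restrict_space_iff)
    thus ?thesis by (rule eventually_mono) auto
  qed
  have "{0<..<1} \<subseteq> ?C"
    using mem_closed_if_AE_lebesgue_open[OF open_greaterThanLessThan cl ae] by (rule subsetI)
  hence "closure {0<..<1} \<subseteq> ?C"
    using cl by (rule closure_minimal)
  thus ?thesis using assms(3) by auto
qed

text \<open>On $C[0,1]$ the norm is the supremum norm.\<close>

lemma Linf_norm_continuous:
  assumes "continuous_on {0..1} x"
  shows "Linf_norm x = (SUP t\<in>{0..1}. \<bar>x t\<bar>)"
proof -
  let ?S = "SUP t\<in>{0..1}. \<bar>x t\<bar>"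
  let ?e = "esssup unit_lebesgue (\<lambda>t. ereal \<bar>x t\<bar>)"
  have meas: "x \<in> borel_measurable unit_lebesgue"
    using assms by (rule continuous_imp_measurable_on_sets_lebesgue) auto
  have bdd: "bdd_above ((\<lambda>t. \<bar>x t\<bar>) ` {0..1})"
    by (rule bounded_imp_bdd_above, rule compact_imp_bounded, rule compact_continuous_image)
       (auto intro!: continuous_on_rabs assms)
  have upper: "?e \<le> ereal ?S"
  proof (rule esssup_I)
    show "(\<lambda>t. ereal \<bar>x t\<bar>) \<in> borel_measurable unit_lebesgue"
      using meas by measurable
    show "AE t in unit_lebesgue. ereal \<bar>x t\<bar> \<le> ereal ?S"
    proof (rule AE_I2)
      fix t assume "t \<in> space unit_lebesgue"
      hence "t \<in> {0..1}" by simp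
      hence "\<bar>x t\<bar> \<le> ?S" using bdd by (rule cSUP_upper)
      thus "ereal \<bar>x t\<bar> \<le> ereal ?S" by simp
    qed
  qed
  have ae: "AE t in unit_lebesgue. ereal \<bar>x t\<bar> \<le> ?e"
    by (rule esssup_AE)
  have "?e \<noteq> -\<infinity>"
  proof
    assume "?e = -\<infinity>"
    with ae have "AE t in unit_lebesgue. \<bar>x t\<bar> \<le> -1"
      by (simp only:) (erule eventually_mono, simp)
    from AE_bound_imp_bound[OF assms this, of 0] show False by simp
  qed
  obtain e where e: "?e = ereal e"
    using upper \<open>?e \<noteq> -\<infinity>\<close> by (cases ?e) simp_all
  have "?S \<le> e"
  proof (rule cSUP_least)
    have "AE t in unit_lebesgue. \<bar>x t\<bar> \<le> e"
      using ae unfolding e by simp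
    thus "\<bar>x t\<bar> \<le> e" if "t \<in> {0..1}" for t
      using AE_bound_imp_bound[OF assms] that by blast
  qed simp
  with upper e show ?thesis by (simp add: Linf_norm_def)
qed


section \<open>Smoothness classes\<close>

text \<open>
  $C^m[0,1]$, with one-sided derivatives at the end points.
\<close>

definition Cm :: "nat \<Rightarrow> (real \<Rightarrow> real) \<Rightarrow> bool" where
  "Cm m g \<longleftrightarrow> (\<exists>D :: nat \<Rightarrow> real \<Rightarrow> real.
     (\<forall>t\<in>{0..1}. D 0 t = g t) \<and>
     (\<forall>k<m. \<forall>t\<in>{0..1}. (D k has_real_derivative D (Suc k) t) (at t within {0..1})) \<and>
     (\<forall>k\<le>m. continuous_on {0..1} (D k)))"

text \<open>
  The partial derivatives $D^{(j,k)}g = \partial^{j+k} g/\partial s^j\partial t^k$,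
  $(j,k)\in J$, exist and are continuous on \<open>\<Omega>\<close>; derivatives are taken within the sections
  of \<open>\<Omega>\<close>, so they are one-sided at the boundary. At a corner where the section is a single
  point the derivative condition is void and $D^{(j,k)}g$ is determined by continuity.
  \<open>J\<close> is meant to be closed under decreasing either index. On a compact \<open>\<Omega>\<close> the
  derivatives are automatically bounded.
\<close>

definition continuous_partials_on ::
    "(real \<times> real) set \<Rightarrow> (nat \<times> nat) set \<Rightarrow> (real \<Rightarrow> real \<Rightarrow> real) \<Rightarrow> bool" where
  "continuous_partials_on \<Omega> J g \<longleftrightarrow> (\<exists>D :: nat \<Rightarrow> nat \<Rightarrow> real \<Rightarrow> real \<Rightarrow> real.
     (\<forall>(s, t)\<in>\<Omega>. D 0 0 s t = g s t) \<and>
     (\<forall>j k. (Suc j, k) \<in> J \<longrightarrow> (\<forall>(s, t)\<in>\<Omega>.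
        ((\<lambda>u. D j k u t) has_real_derivative D (Suc j) k s t) (at s within {u. (u, t) \<in> \<Omega>}))) \<and>
     (\<forall>j k. (j, Suc k) \<in> J \<longrightarrow> (\<forall>(s, t)\<in>\<Omega>.
        ((\<lambda>v. D j k s v) has_real_derivative D j (Suc k) s t) (at t within {v. (s, v) \<in> \<Omega>}))) \<and>
     (\<forall>(j, k)\<in>J. continuous_on \<Omega> (\<lambda>(s, t). D j k s t)))"


section \<open>Kernels of Green's function type\<close>

definition Omega1 :: "(real \<times> real) set" where
  "Omega1 = {(s, t). 0 \<le> t \<and> t \<le> s \<and> s \<le> 1}"

definition Omega2 :: "(real \<times> real) set" where
  "Omega2 = {(s, t). 0 \<le> s \<and> s \<le> t \<and> t \<le> 1}"

text \<open>
  The two index sets express $\kappa_i\in C^\alpha(\Omega_i)$ and the standing assumption that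
  $D^{(j,k)}\kappa_i$ exists and is continuous for all $j,k\in\{0,1,2\}$.
\<close>

definition green_type_kernel :: "nat \<Rightarrow> (real \<Rightarrow> real \<Rightarrow> real) \<Rightarrow> bool" where
  "green_type_kernel \<alpha> \<kappa> \<longleftrightarrow>
     continuous_on ({0..1} \<times> {0..1}) (\<lambda>(s, t). \<kappa> s t) \<and>
     (\<exists>\<kappa>1 \<kappa>2.
        continuous_partials_on Omega1 {(j, k). j + k \<le> \<alpha>} \<kappa>1 \<and>
        continuous_partials_on Omega2 {(j, k). j + k \<le> \<alpha>} \<kappa>2 \<and>
        continuous_partials_on Omega1 ({0..2} \<times> {0..2}) \<kappa>1 \<and>
        continuous_partials_on Omega2 ({0..2} \<times> {0..2}) \<kappa>2 \<and>
        (\<forall>(s, t)\<in>Omega1. \<kappa> s t = \<kappa>1 s t) \<and>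
        (\<forall>(s, t)\<in>Omega2. \<kappa> s t = \<kappa>2 s t) \<and>
        (\<forall>s\<in>{0..1}. \<kappa>1 s s = \<kappa>2 s s))"

definition fredholm_op :: "(real \<Rightarrow> real \<Rightarrow> real) \<Rightarrow> (real \<Rightarrow> real) \<Rightarrow> real \<Rightarrow> real" where
  "fredholm_op \<kappa> x s = (LINT t|unit_lebesgue. \<kappa> s t * x t)"

definition fredholm_eigenvalue :: "(real \<Rightarrow> real \<Rightarrow> real) \<Rightarrow> real \<Rightarrow> bool" where
  "fredholm_eigenvalue \<kappa> \<mu> \<longleftrightarrow> (\<exists>x\<in>Linf.
     \<not> (AE s in unit_lebesgue. x s = 0) \<and>
     (AE s in unit_lebesgue. fredholm_op \<kappa> x s = \<mu> * x s))"


section \<open>Piecewise polynomials and interpolatory projections\<close>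

definition mesh_point :: "nat \<Rightarrow> nat \<Rightarrow> real" where
  "mesh_point n j = real j / real n"

definition mesh_interval :: "nat \<Rightarrow> nat \<Rightarrow> real set" where
  "mesh_interval n j = {mesh_point n (j - 1)..mesh_point n j}"

definition colloc_point :: "nat \<Rightarrow> nat \<Rightarrow> nat \<Rightarrow> nat \<Rightarrow> real" where
  "colloc_point r n j k =
     (if r = 0 then (mesh_point n (j - 1) + mesh_point n j) / 2
      else mesh_point n (j - 1) + real k * (1 / real n) / (2 * real r))"

text \<open>
  The restriction to \<open>\<Delta>\<^sub>j\<close> is taken in $L^\infty$, that is, up to null sets; in particular no
  matching is imposed at the mesh points shared by two neighbouring intervals.
\<close>

definition pp_space :: "nat \<Rightarrow> nat \<Rightarrow> (real \<Rightarrow> real) set" where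
  "pp_space r n = {x \<in> Linf. \<forall>j\<in>{1..n}. \<exists>p :: real poly. degree p \<le> 2 * r \<and>
     (AE t in lebesgue_on (mesh_interval n j). x t = poly p t)}"

definition is_pp_interpolant :: "nat \<Rightarrow> nat \<Rightarrow> (real \<Rightarrow> real) \<Rightarrow> (real \<Rightarrow> real) \<Rightarrow> bool" where
  "is_pp_interpolant r n x y \<longleftrightarrow> y \<in> Linf \<and>
     (\<forall>j\<in>{1..n}. \<exists>p :: real poly. degree p \<le> 2 * r \<and>
        (\<forall>k\<in>{0..2 * r}. poly p (colloc_point r n j k) = x (colloc_point r n j k)) \<and>
        (AE t in lebesgue_on (mesh_interval n j). y t = poly p t))"

text \<open>
  \<open>P n\<close> is a linear projection of $L^\infty[0,1]$ onto the piecewise polynomials, bounded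
  uniformly in \<open>n\<close>, which on $C[0,1]$ is piecewise interpolation at the collocation points.
  The extension from $C[0,1]$ to $L^\infty[0,1]$ is not unique, so this is a predicate rather
  than a definition of one operator. Linearity and boundedness make \<open>P n\<close> well defined on
  classes of functions modulo null sets.
\<close>

definition interpolatory_projections ::
    "nat \<Rightarrow> (nat \<Rightarrow> (real \<Rightarrow> real) \<Rightarrow> real \<Rightarrow> real) \<Rightarrow> bool" where
  "interpolatory_projections r P \<longleftrightarrow>
     (\<forall>n\<ge>1. \<forall>x. continuous_on {0..1} x \<longrightarrow> is_pp_interpolant r n x (P n x)) \<and>
     (\<forall>n\<ge>1. \<forall>x\<in>Linf. P n x \<in> pp_space r n) \<and>
     (\<forall>n\<ge>1. \<forall>x\<in>pp_space r n. AE t in unit_lebesgue. P n x t = x t) \<and>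
     (\<forall>n\<ge>1. \<forall>x\<in>Linf. \<forall>y\<in>Linf. \<forall>a b :: real. AE t in unit_lebesgue.
        P n (\<lambda>u. a * x u + b * y u) t = a * P n x t + b * P n y t) \<and>
     (\<exists>M. \<forall>n\<ge>1. \<forall>x\<in>Linf. Linf_norm (P n x) \<le> M * Linf_norm x)"


section \<open>Collocation and iterated collocation\<close>

definition collocation_solution ::
    "(real \<Rightarrow> real \<Rightarrow> real) \<Rightarrow> (real \<Rightarrow> real) \<Rightarrow> ((real \<Rightarrow> real) \<Rightarrow> real \<Rightarrow> real) \<Rightarrow>
     (real \<Rightarrow> real) \<Rightarrow> bool" where
  "collocation_solution \<kappa> f Pn x \<longleftrightarrow> x \<in> Linf \<and>
     (AE t in unit_lebesgue. x t - Pn (fredholm_op \<kappa> x) t = Pn f t)"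

definition iterated_collocation ::
    "(real \<Rightarrow> real \<Rightarrow> real) \<Rightarrow> (real \<Rightarrow> real) \<Rightarrow> (real \<Rightarrow> real) \<Rightarrow> real \<Rightarrow> real" where
  "iterated_collocation \<kappa> f x = (\<lambda>s. fredholm_op \<kappa> x s + f s)"

end

theory Submission
  imports Defs "HOL-Complex_Analysis.Great_Picard"
begin

text \<open>
  The argument needs no Fredholm alternative. By Arzela--Ascoli and the eigenvalue assumption,
  \<open>\<parallel>x\<parallel> \<le> C \<parallel>x - P\<^sub>n K x\<parallel>\<close> for all large \<open>n\<close>. The collocation equation is a square linear system for
  the values at the collocation points, so this injectivity estimate also yields solvability.
  Since \<open>(I - P\<^sub>n K) (\<phi> - \<phi>\<^sup>C) = \<phi> - P\<^sub>n \<phi>\<close>, the first rate is the interpolation error. Stability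
  likewise bounds \<open>\<phi> - \<phi>\<^sup>S\<close> by \<open>K (\<phi> - P\<^sub>n \<phi>)\<close>. There the extra order comes from symmetry: the nodes
  of each mesh interval are symmetric about its midpoint and \<open>2r\<close> is even, so reflecting the interval
  gains a power of \<open>h\<close> in the interpolation error, and the kernel, being Lipschitz in its second
  argument (also across the diagonal), changes only by \<open>O(h)\<close> under the reflection.
\<close>

section \<open>The essential supremum norm\<close>

text \<open>Two obstacles shape the proof. Functions count only up to null sets, and
  \<open>P n\<close> is explicit only on continuous functions. However,
  \<open>fredholm_op \<kappa> x\<close> is continuous for every \<open>x\<close> in
  \<open>Linf\<close>, so in the collocation equation \<open>P n\<close> meets only continuous
  functions, and their nodal values make sense. A discontinuous argument of \<open>P n\<close>
  occurs only in the proof that \<open>P n y\<close> tends to \<open>y\<close>, where the uniform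
  bound on the projections handles it. Secondly, no constant may depend on the mesh. Interpolation
  is therefore moved to fixed nodes in [-1/2, 1/2], where one Lebesgue constant serves all intervals
  and all \<open>n\<close>. In the stability proof compactness gives convergence only of the images
  under the integral operator. The small residual is what carries it over: \<open>x\<close> is close
  to \<open>P n (fredholm_op \<kappa> x)\<close>, so the normalised sequence itself converges in
  norm and its limit cannot vanish.\<close>

lemma AE_unit_const_le:
  assumes "AE t in unit_lebesgue. a \<le> (b::real)"
  shows "a \<le> b"
proof (rule ccontr)
  assume "\<not> a \<le> b"
  \<comment> \<open>A false constant inequality that holds almost everywhere makes every statement
    hold almost everywhere; this one is refuted because the unit interval is not a null set.\<close>
  then have "AE t in unit_lebesgue. \<bar>0::real\<bar> \<le> -1"
    using assms by simp
  from AE_bound_imp_bound[OF continuous_on_const this, of 0] show False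
    by simp
qed

lemma
  assumes "x \<in> borel_measurable unit_lebesgue" and "AE t in unit_lebesgue. \<bar>x t\<bar> \<le> c"
  shows LinfI: "x \<in> Linf" and Linf_norm_le: "Linf_norm x \<le> c"
proof -
  let ?e = "esssup unit_lebesgue (\<lambda>t. ereal \<bar>x t\<bar>)"
  have e: "?e \<le> ereal c"
  proof (rule esssup_I)
    show "(\<lambda>t. ereal \<bar>x t\<bar>) \<in> borel_measurable unit_lebesgue"
      using assms(1) by measurable
  qed (use assms(2) in simp)
  also have "ereal c < \<infinity>" by simp
  finally show "x \<in> Linf"
    using assms(1) by (simp add: Linf_def)
  \<comment> \<open>Needed for the essential supremum \<open>-\<infinity>\<close>, which
    \<open>real_of_ereal\<close> sends to 0.\<close>
  have "0 \<le> c"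
    using assms(2) by (intro AE_unit_const_le) (auto elim!: eventually_mono)
  then show "Linf_norm x \<le> c"
    using e by (cases ?e) (auto simp: Linf_norm_def)
qed

lemma Linf_measurable: "x \<in> Linf \<Longrightarrow> x \<in> borel_measurable unit_lebesgue"
  by (simp add: Linf_def)

lemma AE_Linf_norm:
  assumes "x \<in> Linf"
  shows "AE t in unit_lebesgue. \<bar>x t\<bar> \<le> Linf_norm x"
proof -
  let ?e = "esssup unit_lebesgue (\<lambda>t. ereal \<bar>x t\<bar>)"
  have ae: "AE t in unit_lebesgue. ereal \<bar>x t\<bar> \<le> ?e"
    by (rule esssup_AE)
  have "?e < \<infinity>"
    using assms by (simp add: Linf_def)
  show ?thesis
  proof (cases ?e)
    case (real r)
    with ae show ?thesis by (simp add: Linf_norm_def)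
  next
    case PInf
    with \<open>?e < \<infinity>\<close> show ?thesis by simp
  next
    case MInf
    with ae show ?thesis by (auto elim!: eventually_mono)
  qed
qed

lemma Linf_norm_nonneg: "x \<in> Linf \<Longrightarrow> 0 \<le> Linf_norm x"
  by (rule AE_unit_const_le, rule eventually_mono[OF AE_Linf_norm]) auto

lemma Linf_norm_mono:
  assumes "x \<in> Linf" and "y \<in> Linf" and "AE t in unit_lebesgue. \<bar>x t\<bar> \<le> \<bar>y t\<bar>"
  shows "Linf_norm x \<le> Linf_norm y"
proof (rule Linf_norm_le[OF Linf_measurable[OF assms(1)]])
  show "AE t in unit_lebesgue. \<bar>x t\<bar> \<le> Linf_norm y"
    using assms(3) AE_Linf_norm[OF assms(2)] by eventually_elim simp
qed

lemma Linf_lincomb: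
  assumes "x \<in> Linf" and "y \<in> Linf"
  shows "(\<lambda>t. a * x t + b * y t) \<in> Linf"
proof (rule LinfI)
  show "(\<lambda>t. a * x t + b * y t) \<in> borel_measurable unit_lebesgue"
    using assms[THEN Linf_measurable] by measurable
  show "AE t in unit_lebesgue. \<bar>a * x t + b * y t\<bar> \<le> \<bar>a\<bar> * Linf_norm x + \<bar>b\<bar> * Linf_norm y"
    using assms[THEN AE_Linf_norm]
  proof eventually_elim
    case (elim t)
    have "\<bar>a * x t + b * y t\<bar> \<le> \<bar>a\<bar> * \<bar>x t\<bar> + \<bar>b\<bar> * \<bar>y t\<bar>"
      by (metis abs_mult abs_triangle_ineq)
    also have "\<dots> \<le> \<bar>a\<bar> * Linf_norm x + \<bar>b\<bar> * Linf_norm y"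
      using elim by (intro add_mono mult_left_mono) auto
    finally show ?case .
  qed
qed

lemma Linf_diff: "x \<in> Linf \<Longrightarrow> y \<in> Linf \<Longrightarrow> (\<lambda>t. x t - y t) \<in> Linf"
  using Linf_lincomb[of x y 1 "-1"] by simp

lemma Linf_add: "x \<in> Linf \<Longrightarrow> y \<in> Linf \<Longrightarrow> (\<lambda>t. x t + y t) \<in> Linf"
  using Linf_lincomb[of x y 1 1] by simp

lemma continuous_bounded_unit:
  fixes x :: "real \<Rightarrow> real"
  assumes "continuous_on {0..1} x"
  obtains c where "\<And>t. t \<in> {0..1} \<Longrightarrow> \<bar>x t\<bar> \<le> c"
  using compact_imp_bounded[OF compact_continuous_image[OF assms]]
  by (force simp: bounded_iff)

lemma Linf_norm_le_everywhere:
  assumes "x \<in> borel_measurable unit_lebesgue" and "\<And>t. t \<in> {0..1} \<Longrightarrow> \<bar>x t\<bar> \<le> c"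
  shows "Linf_norm x \<le> c"
  using assms by (intro Linf_norm_le AE_I2) auto

lemma continuous_measurable_unit:
  "continuous_on {0..1} x \<Longrightarrow> x \<in> borel_measurable unit_lebesgue"
  by (rule continuous_imp_measurable_on_sets_lebesgue) auto

lemma continuous_imp_Linf:
  assumes "continuous_on {0..1} x"
  shows "x \<in> Linf"
proof -
  obtain c where "\<And>t. t \<in> {0..1} \<Longrightarrow> \<bar>x t\<bar> \<le> c"
    by (rule continuous_bounded_unit[OF assms]) blast
  then show ?thesis
    by (intro LinfI[OF continuous_measurable_unit[OF assms]] AE_I2) auto
qed

section \<open>Fredholm operators with continuous kernel\<close>

locale continuous_kernel =
  fixes \<kappa> :: "real \<Rightarrow> real \<Rightarrow> real"
  assumes continuous: "continuous_on ({0..1} \<times> {0..1}) (\<lambda>(s, t). \<kappa> s t)"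
begin

lemma bounded:
  obtains B where "B > 0" and "\<And>s t. s \<in> {0..1} \<Longrightarrow> t \<in> {0..1} \<Longrightarrow> \<bar>\<kappa> s t\<bar> \<le> B"
proof -
  have "bounded ((\<lambda>(s, t). \<kappa> s t) ` ({0..1} \<times> {0..1}))"
    by (intro compact_imp_bounded compact_continuous_image continuous compact_Times) auto
  then obtain B where "B > 0" "\<And>z. z \<in> {0..1} \<times> {0..1} \<Longrightarrow> norm ((\<lambda>(s, t). \<kappa> s t) z) \<le> B"
    by (auto simp: bounded_pos)
  then show thesis
    by (intro that[of B]) auto
qed

lemma continuous_section: "s \<in> {0..1} \<Longrightarrow> continuous_on {0..1} (\<kappa> s)"
  using continuous_on_compose2[OF continuous, of "{0..1}" "Pair s"]
  by (force intro!: continuous_intros)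

lemma integrable_kernel_mult:
  assumes "s \<in> {0..1}" and "x \<in> Linf"
  shows "integrable unit_lebesgue (\<lambda>t. \<kappa> s t * x t)"
proof -
  obtain B where B: "B > 0" "\<And>s t. s \<in> {0..1} \<Longrightarrow> t \<in> {0..1} \<Longrightarrow> \<bar>\<kappa> s t\<bar> \<le> B"
    by (rule bounded) blast
  show ?thesis
  proof (rule integrableI_bounded_set[where A = "{0..1}" and B = "B * Linf_norm x"])
    show "(\<lambda>t. \<kappa> s t * x t) \<in> borel_measurable unit_lebesgue"
      using continuous_measurable_unit[OF continuous_section[OF assms(1)]]
        Linf_measurable[OF assms(2)] by measurable
    show "AE t in unit_lebesgue. t \<in> {0..1} \<longrightarrow> norm (\<kappa> s t * x t) \<le> B * Linf_norm x"
      using AE_Linf_norm[OF assms(2)]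
      by eventually_elim (auto simp: abs_mult intro!: mult_mono B assms order.strict_implies_order[OF B(1)])
  qed (auto simp: sets_restrict_space_iff emeasure_restrict_space)
qed

text \<open>The bound \<open>c\<close> is left free instead of being \<open>Linf_norm x\<close>, so
  that the estimate is uniform over a whole bounded family of inputs.\<close>

lemma abs_fredholm_diff_le:
  assumes "s \<in> {0..1}" and "s' \<in> {0..1}" and "x \<in> Linf" and "AE t in unit_lebesgue. \<bar>x t\<bar> \<le> c"
    and "\<And>t. t \<in> {0..1} \<Longrightarrow> \<bar>\<kappa> s t - \<kappa> s' t\<bar> \<le> b"
  shows "\<bar>fredholm_op \<kappa> x s - fredholm_op \<kappa> x s'\<bar> \<le> b * c"
proof -
  have i: "integrable unit_lebesgue (\<lambda>t. \<kappa> s t * x t - \<kappa> s' t * x t)"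
    by (intro Bochner_Integration.integrable_diff integrable_kernel_mult assms)
  have "\<bar>fredholm_op \<kappa> x s - fredholm_op \<kappa> x s'\<bar> = norm (LINT t|unit_lebesgue. \<kappa> s t * x t - \<kappa> s' t * x t)"
    unfolding fredholm_op_def
    by (subst Bochner_Integration.integral_diff) (auto intro!: integrable_kernel_mult assms)
  also have "\<dots> \<le> (LINT t|unit_lebesgue. norm (\<kappa> s t * x t - \<kappa> s' t * x t))"
    by (rule integral_norm_bound)
  also have "\<dots> \<le> (LINT t|unit_lebesgue. b * c)"
  proof (rule integral_mono_AE)
    show "AE t in unit_lebesgue. norm (\<kappa> s t * x t - \<kappa> s' t * x t) \<le> b * c"
      using assms(4) AE_space
    proof eventually_elim
      case (elim t)
      then have "\<bar>\<kappa> s t - \<kappa> s' t\<bar> * \<bar>x t\<bar> \<le> b * c"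
        using assms(5)[of t] by (intro mult_mono) auto
      then show ?case by (simp add: abs_mult flip: left_diff_distrib)
    qed
  qed (use i in auto)
  finally show ?thesis by (simp add: measure_restrict_space)
qed

lemma abs_fredholm_le:
  assumes "s \<in> {0..1}" and "x \<in> Linf" and "AE t in unit_lebesgue. \<bar>x t\<bar> \<le> c"
    and "\<And>t. t \<in> {0..1} \<Longrightarrow> \<bar>\<kappa> s t\<bar> \<le> b"
  shows "\<bar>fredholm_op \<kappa> x s\<bar> \<le> b * c"
proof -
  have "\<bar>fredholm_op \<kappa> x s\<bar> \<le> (LINT t|unit_lebesgue. norm (\<kappa> s t * x t))"
    unfolding fredholm_op_def using integral_norm_bound by (metis real_norm_def)
  also have "\<dots> \<le> (LINT t|unit_lebesgue. b * c)"
  proof (rule integral_mono_AE)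
    show "AE t in unit_lebesgue. norm (\<kappa> s t * x t) \<le> b * c"
      using assms(3) AE_space
    proof eventually_elim
      case (elim t)
      then have "\<bar>\<kappa> s t\<bar> * \<bar>x t\<bar> \<le> b * c"
        using assms(4)[of t] by (intro mult_mono) auto
      then show ?case by (simp add: abs_mult)
    qed
  qed (use integrable_kernel_mult[OF assms(1,2)] in auto)
  finally show ?thesis by (simp add: measure_restrict_space)
qed

lemma fredholm_lincomb:
  assumes "s \<in> {0..1}" and "x \<in> Linf" and "y \<in> Linf"
  shows "fredholm_op \<kappa> (\<lambda>t. a * x t + b * y t) s = a * fredholm_op \<kappa> x s + b * fredholm_op \<kappa> y s"
proof -
  have "fredholm_op \<kappa> (\<lambda>t. a * x t + b * y t) s
      = (LINT t|unit_lebesgue. a * (\<kappa> s t * x t) + b * (\<kappa> s t * y t))"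
    unfolding fredholm_op_def by (simp add: algebra_simps)
  also have "\<dots> = a * fredholm_op \<kappa> x s + b * fredholm_op \<kappa> y s"
    unfolding fredholm_op_def
    by (subst Bochner_Integration.integral_add)
       (auto intro!: integrable_kernel_mult assms)
  finally show ?thesis .
qed

lemma fredholm_cong_AE:
  assumes "s \<in> {0..1}" and "x \<in> Linf" and "y \<in> Linf" and "AE t in unit_lebesgue. x t = y t"
  shows "fredholm_op \<kappa> x s = fredholm_op \<kappa> y s"
  unfolding fredholm_op_def
proof (rule Bochner_Integration.integral_cong_AE)
  show "AE t in unit_lebesgue. \<kappa> s t * x t = \<kappa> s t * y t"
    using assms(4) by eventually_elim simp
qed (use integrable_kernel_mult[OF assms(1)] assms in auto)

text \<open>The modulus comes from the uniform continuity of the kernel on the compact square and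
  depends on \<open>x\<close> only through \<open>c\<close>. This gives continuity of a single image
  as well as the equicontinuity that Arzela-Ascoli asks for.\<close>

lemma fredholm_equicontinuous:
  assumes "e > 0"
  obtains d where "d > 0" and "\<And>x s s'. x \<in> Linf \<Longrightarrow> AE t in unit_lebesgue. \<bar>x t\<bar> \<le> c \<Longrightarrow>
    s \<in> {0..1} \<Longrightarrow> s' \<in> {0..1} \<Longrightarrow> \<bar>s - s'\<bar> < d \<Longrightarrow> \<bar>fredholm_op \<kappa> x s - fredholm_op \<kappa> x s'\<bar> < e"
proof -
  \<comment> \<open>The summand 1 admits \<open>c = 0\<close> and makes \<open>b * c < e\<close>
    strict.\<close>
  define b where "b = e / (1 + \<bar>c\<bar>)"
  have b: "b > 0" "b * c < e"
  proof -
    show "b > 0" using assms by (simp add: b_def add_pos_nonneg)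
    have "b * c \<le> b * \<bar>c\<bar>" using \<open>b > 0\<close> by simp
    also have "\<dots> < b * (1 + \<bar>c\<bar>)" using \<open>b > 0\<close> by simp
    also have "\<dots> = e" by (simp add: b_def)
    finally show "b * c < e" .
  qed
  have "uniformly_continuous_on ({0..1} \<times> {0..1}) (\<lambda>(s, t). \<kappa> s t)"
    by (intro compact_uniformly_continuous continuous compact_Times) auto
  then obtain d where d: "d > 0"
    "\<And>z z'. z \<in> {0..1} \<times> {0..1} \<Longrightarrow> z' \<in> {0..1} \<times> {0..1} \<Longrightarrow> dist z' z < d \<Longrightarrow>
       dist ((\<lambda>(s, t). \<kappa> s t) z') ((\<lambda>(s, t). \<kappa> s t) z) < b"
    using b(1) unfolding uniformly_continuous_on_def by meson
  show thesis
  proof (rule that[OF d(1)])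
    fix x s s'
    assume x: "x \<in> Linf" "AE t in unit_lebesgue. \<bar>x t\<bar> \<le> c"
      and s: "s \<in> {0..1}" "s' \<in> {0..1}" "\<bar>s - s'\<bar> < d"
    have "\<bar>\<kappa> s t - \<kappa> s' t\<bar> \<le> b" if "t \<in> {0..1}" for t
      using d(2)[of "(s', t)" "(s, t)"] s that by (auto simp: dist_Pair_Pair dist_real_def)
    then have "\<bar>fredholm_op \<kappa> x s - fredholm_op \<kappa> x s'\<bar> \<le> b * c"
      by (intro abs_fredholm_diff_le s x)
    with b(2) show "\<bar>fredholm_op \<kappa> x s - fredholm_op \<kappa> x s'\<bar> < e" by simp
  qed
qed

lemma continuous_fredholm:
  assumes "x \<in> Linf"
  shows "continuous_on {0..1} (fredholm_op \<kappa> x)"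
  unfolding continuous_on_iff
proof (intro ballI allI impI)
  fix s e :: real
  assume s: "s \<in> {0..1}" and "0 < e"
  obtain d where "d > 0" "\<And>s s'. s \<in> {0..1} \<Longrightarrow> s' \<in> {0..1} \<Longrightarrow> \<bar>s - s'\<bar> < d \<Longrightarrow>
      \<bar>fredholm_op \<kappa> x s - fredholm_op \<kappa> x s'\<bar> < e"
    using fredholm_equicontinuous[OF \<open>0 < e\<close>] assms AE_Linf_norm[OF assms] by metis
  then show "\<exists>d>0. \<forall>s'\<in>{0..1}. dist s' s < d \<longrightarrow> dist (fredholm_op \<kappa> x s') (fredholm_op \<kappa> x s) < e"
    using s by (auto simp: dist_real_def)
qed

end

section \<open>Piecewise functions, projections and stability\<close>

text \<open>The ceiling gives an interior mesh point to the interval on its left, and gives 0 the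
  index 0, which belongs to no interval. Hence the left end point of an interval is excluded again
  and again below; only finitely many points are affected.\<close>

definition mesh_index :: "nat \<Rightarrow> real \<Rightarrow> nat" where
  "mesh_index n t = nat \<lceil>real n * t\<rceil>"

definition piecewise :: "nat \<Rightarrow> (nat \<Rightarrow> real \<Rightarrow> real) \<Rightarrow> real \<Rightarrow> real" where
  "piecewise n g t = g (mesh_index n t) t"

lemma mesh_index_eqI:
  assumes "n \<ge> 1" and "j \<ge> 1" and "t \<in> mesh_interval n j" and "t \<noteq> mesh_point n (j - 1)"
  shows "mesh_index n t = j"
proof -
  have "real (j - 1) < real n * t" "real n * t \<le> real j"
    using assms by (auto simp: mesh_interval_def mesh_point_def field_simps)
  then have "\<lceil>real n * t\<rceil> = int j"
    using assms(2) by (intro ceiling_unique) (auto simp: of_nat_diff)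
  then show ?thesis by (simp add: mesh_index_def)
qed

lemma mesh_index_works:
  assumes "n \<ge> 1" and "t \<in> {0<..1}"
  shows "mesh_index n t \<in> {1..n}" and "t \<in> mesh_interval n (mesh_index n t)"
proof -
  define j where "j = mesh_index n t"
  have nt: "0 < real n * t" "real n * t \<le> real n"
    using assms by (auto simp: mult_left_le)
  then have "1 \<le> \<lceil>real n * t\<rceil>" "\<lceil>real n * t\<rceil> \<le> int n"
    by (auto simp: ceiling_le_iff)
  then have j: "int j = \<lceil>real n * t\<rceil>" "j \<in> {1..n}"
    by (auto simp: j_def mesh_index_def nat_le_iff le_nat_iff)
  have "real n * t \<le> real j" "real j - 1 < real n * t"
    using j(1) by linarith+
  then show "mesh_index n t \<in> {1..n}" "t \<in> mesh_interval n (mesh_index n t)"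
    using j(2) assms(1) unfolding j_def[symmetric]
    by (auto simp: mesh_interval_def mesh_point_def field_simps of_nat_diff)
qed

lemma mesh_interval_subset:
  assumes "j \<in> {1..n}"
  shows "mesh_interval n j \<subseteq> {0..1}"
proof -
  have "mesh_point n j \<le> 1" "0 \<le> mesh_point n (j - 1)"
    using assms by (auto simp: mesh_point_def)
  then show ?thesis by (auto simp: mesh_interval_def)
qed

lemma measurable_mesh_index [measurable]: "mesh_index n \<in> measurable unit_lebesgue (count_space UNIV)"
proof -
  have "(\<lambda>t. nat \<lceil>real n * t\<rceil>) \<in> measurable borel (count_space UNIV)"
    by measurable
  then show ?thesis
    unfolding mesh_index_def[abs_def]
    by (intro measurable_restrict_space1 measurable_completion) simp
qed

lemma AE_unit_neq: "AE t in unit_lebesgue. t \<noteq> a"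
proof -
  have "AE t in lebesgue. t \<noteq> a"
    by (rule AE_I[where N="{a}"]) auto
  then show ?thesis
    by (simp add: AE_restrict_space_iff) (erule eventually_mono, simp)
qed

lemma AE_mesh_neq: "AE t in lebesgue_on (mesh_interval n j). t \<noteq> a"
proof -
  have "AE t in lebesgue. t \<noteq> a"
    by (rule AE_I[where N="{a}"]) auto
  then show ?thesis
    by (simp add: AE_restrict_space_iff mesh_interval_def) (erule eventually_mono, simp)
qed

text \<open>One null set for each of the finitely many intervals is discarded, together with the
  point 0, whose index is out of range.\<close>

lemma AE_unit_mesh:
  assumes "n \<ge> 1"
    and "\<And>j. j \<in> {1..n} \<Longrightarrow> AE t in lebesgue_on (mesh_interval n j). Q j t"
  shows "AE t in unit_lebesgue. Q (mesh_index n t) t"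
proof -
  have "AE t in lebesgue. \<forall>j\<in>{1..n}. t \<in> mesh_interval n j \<longrightarrow> Q j t"
    using assms(2) by (intro AE_finite_allI) (auto simp: AE_restrict_space_iff mesh_interval_def)
  then have "AE t in unit_lebesgue. \<forall>j\<in>{1..n}. t \<in> mesh_interval n j \<longrightarrow> Q j t"
    by (simp add: AE_restrict_space_iff) (erule eventually_mono, simp)
  then show ?thesis
    using AE_unit_neq[of 0] AE_space
  proof eventually_elim
    case (elim t)
    then have "t \<in> {0<..1}" by auto
    from mesh_index_works[OF assms(1) this] elim show ?case by blast
  qed
qed

lemma piecewise_measurable:
  assumes "\<And>j. g j \<in> borel_measurable unit_lebesgue"
  shows "piecewise n g \<in> borel_measurable unit_lebesgue"
  unfolding piecewise_def[abs_def]
  by (rule measurable_compose_countable'[OF assms measurable_mesh_index]) auto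

lemma piecewise_poly_pp_space:
  assumes "n \<ge> 1" and "\<And>j. degree (p j) \<le> 2 * r"
  shows "piecewise n (\<lambda>j. poly (p j)) \<in> pp_space r n"
proof -
  have cont: "continuous_on {0..1} (poly (p j))" for j
    by (intro continuous_intros)
  have "\<forall>j. \<exists>c. \<forall>t\<in>{0..1}. \<bar>poly (p j) t\<bar> \<le> c"
    using continuous_bounded_unit[OF cont] by metis
  then obtain c where c: "\<And>j t. t \<in> {0..1} \<Longrightarrow> \<bar>poly (p j) t\<bar> \<le> c j"
    by metis
  have "piecewise n (\<lambda>j. poly (p j)) \<in> Linf"
  proof (rule LinfI)
    show "piecewise n (\<lambda>j. poly (p j)) \<in> borel_measurable unit_lebesgue"
      by (intro piecewise_measurable continuous_measurable_unit cont)
    \<comment> \<open>The sum is merely a convenient common bound for the finitely many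
      pieces.\<close>
    show "AE t in unit_lebesgue. \<bar>piecewise n (\<lambda>j. poly (p j)) t\<bar> \<le> (\<Sum>j\<in>{1..n}. \<bar>c j\<bar>)"
      using AE_unit_neq[of 0] AE_space
    proof eventually_elim
      case (elim t)
      then have t: "t \<in> {0<..1}" "t \<in> {0..1}" by auto
      have "\<bar>piecewise n (\<lambda>j. poly (p j)) t\<bar> \<le> \<bar>c (mesh_index n t)\<bar>"
        using c[OF t(2), of "mesh_index n t"] by (simp add: piecewise_def)
      also have "\<dots> \<le> (\<Sum>j\<in>{1..n}. \<bar>c j\<bar>)"
        using mesh_index_works(1)[OF assms(1) t(1)] by (intro member_le_sum) auto
      finally show ?case .
    qed
  qed
  moreover have "AE t in lebesgue_on (mesh_interval n j). piecewise n (\<lambda>j. poly (p j)) t = poly (p j) t"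
    if "j \<in> {1..n}" for j
    using AE_mesh_neq[of "mesh_point n (j - 1)" n j] AE_space
  proof eventually_elim
    case (elim t)
    then have "mesh_index n t = j"
      using that assms(1) by (intro mesh_index_eqI) (auto simp: mesh_interval_def)
    then show ?case by (simp add: piecewise_def)
  qed
  ultimately show ?thesis
    using assms(2) unfolding pp_space_def by blast
qed

lemma is_pp_interpolantE:
  assumes "is_pp_interpolant r n x y" and "n \<ge> 1"
  obtains p where "\<And>j. degree (p j) \<le> 2 * r"
    and "\<And>j k. j \<in> {1..n} \<Longrightarrow> k \<in> {0..2 * r} \<Longrightarrow>
           poly (p j) (colloc_point r n j k) = x (colloc_point r n j k)"
    and "AE t in unit_lebesgue. y t = piecewise n (\<lambda>j. poly (p j)) t"
proof -
  have "\<forall>j\<in>{1..n}. \<exists>p :: real poly. degree p \<le> 2 * r \<and>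
        (\<forall>k\<in>{0..2 * r}. poly p (colloc_point r n j k) = x (colloc_point r n j k)) \<and>
        (AE t in lebesgue_on (mesh_interval n j). y t = poly p t)"
    using assms(1) unfolding is_pp_interpolant_def by blast
  then obtain p :: "nat \<Rightarrow> real poly" where "\<forall>j\<in>{1..n}. degree (p j) \<le> 2 * r \<and>
        (\<forall>k\<in>{0..2 * r}. poly (p j) (colloc_point r n j k) = x (colloc_point r n j k)) \<and>
        (AE t in lebesgue_on (mesh_interval n j). y t = poly (p j) t)"
    unfolding bchoice_iff by blast
  then have p: "\<And>j. j \<in> {1..n} \<Longrightarrow> degree (p j) \<le> 2 * r"
    "\<And>j k. j \<in> {1..n} \<Longrightarrow> k \<in> {0..2 * r} \<Longrightarrow> poly (p j) (colloc_point r n j k) = x (colloc_point r n j k)"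
    "\<And>j. j \<in> {1..n} \<Longrightarrow> AE t in lebesgue_on (mesh_interval n j). y t = poly (p j) t"
    by blast+
  \<comment> \<open>Extension by the zero polynomial makes the degree bound hold for every index,
    without a side condition.\<close>
  define q where "q j = (if j \<in> {1..n} then p j else 0)" for j
  show thesis
  proof (rule that)
    show "degree (q j) \<le> 2 * r" for j
      using p(1) by (auto simp: q_def)
    show "poly (q j) (colloc_point r n j k) = x (colloc_point r n j k)"
      if "j \<in> {1..n}" "k \<in> {0..2 * r}" for j k
      using p(2)[OF that] that by (auto simp: q_def)
    have "AE t in unit_lebesgue. y t = poly (q (mesh_index n t)) t"
      using p(3) by (intro AE_unit_mesh[OF assms(2), of "\<lambda>j t. y t = poly (q j) t"]) (auto simp: q_def)
    then show "AE t in unit_lebesgue. y t = piecewise n (\<lambda>j. poly (q j)) t"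
      by (simp add: piecewise_def)
  qed
qed

section \<open>Consequences of the projection axioms\<close>

locale projections =
  fixes r :: nat and P :: "nat \<Rightarrow> (real \<Rightarrow> real) \<Rightarrow> real \<Rightarrow> real"
  assumes proj: "interpolatory_projections r P"
begin

lemma interpolant: "n \<ge> 1 \<Longrightarrow> continuous_on {0..1} x \<Longrightarrow> is_pp_interpolant r n x (P n x)"
  using proj unfolding interpolatory_projections_def by blast

lemma P_Linf: "n \<ge> 1 \<Longrightarrow> x \<in> Linf \<Longrightarrow> P n x \<in> Linf"
  using proj unfolding interpolatory_projections_def pp_space_def by blast

lemma P_pp_space: "n \<ge> 1 \<Longrightarrow> x \<in> pp_space r n \<Longrightarrow> AE t in unit_lebesgue. P n x t = x t"
  using proj unfolding interpolatory_projections_def by blast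

lemma P_lincomb: "n \<ge> 1 \<Longrightarrow> x \<in> Linf \<Longrightarrow> y \<in> Linf \<Longrightarrow>
    AE t in unit_lebesgue. P n (\<lambda>u. a * x u + b * y u) t = a * P n x t + b * P n y t"
  using proj unfolding interpolatory_projections_def by blast

lemma P_diff: "n \<ge> 1 \<Longrightarrow> x \<in> Linf \<Longrightarrow> y \<in> Linf \<Longrightarrow>
    AE t in unit_lebesgue. P n (\<lambda>u. x u - y u) t = P n x t - P n y t"
  using P_lincomb[of n x y 1 "-1"] by simp

lemma P_bounded:
  obtains M where "M > 0" and "\<And>n x. n \<ge> 1 \<Longrightarrow> x \<in> Linf \<Longrightarrow> Linf_norm (P n x) \<le> M * Linf_norm x"
proof -
  obtain M where M: "\<And>n x. n \<ge> 1 \<Longrightarrow> x \<in> Linf \<Longrightarrow> Linf_norm (P n x) \<le> M * Linf_norm x"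
    using proj unfolding interpolatory_projections_def by blast
  show thesis
  \<comment> \<open>The bound is made positive because later proofs divide by it.\<close>
  proof (rule that[of "max 1 M"])
    fix n x assume nx: "n \<ge> (1::nat)" "x \<in> Linf"
    have "Linf_norm (P n x) \<le> M * Linf_norm x" by (rule M[OF nx])
    also have "\<dots> \<le> max 1 M * Linf_norm x"
      by (intro mult_right_mono Linf_norm_nonneg nx) auto
    finally show "Linf_norm (P n x) \<le> max 1 M * Linf_norm x" .
  qed auto
qed

text \<open>\<open>P n\<close> acts on functions, not on classes. Two representatives differ by a
  function of norm at most 0, and boundedness together with linearity annihilates the image of that
  difference.\<close>

lemma P_cong_AE:
  assumes "n \<ge> 1" and "x \<in> Linf" and "y \<in> Linf" and "AE t in unit_lebesgue. x t = y t"
  shows "AE t in unit_lebesgue. P n x t = P n y t"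
proof -
  obtain M where M: "M > 0" "\<And>n x. n \<ge> 1 \<Longrightarrow> x \<in> Linf \<Longrightarrow> Linf_norm (P n x) \<le> M * Linf_norm x"
    by (rule P_bounded) blast
  let ?d = "\<lambda>t. x t - y t"
  have d: "?d \<in> Linf" by (intro Linf_diff assms)
  have "Linf_norm ?d \<le> 0"
    using assms(4) by (intro Linf_norm_le Linf_measurable d) (auto elim!: eventually_mono)
  then have "M * Linf_norm ?d \<le> 0"
    using M(1) by (simp add: mult_nonneg_nonpos)
  with M(2)[OF assms(1) d] have Pd: "Linf_norm (P n ?d) \<le> 0" by simp
  from AE_Linf_norm[OF P_Linf[OF assms(1) d]] P_diff[OF assms(1-3)] show ?thesis
    by eventually_elim (use Pd in linarith)
qed

text \<open>If \<open>z\<close> is fixed by \<open>P n\<close> and \<open>y - z\<close> is at most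
  \<open>c\<close>, then \<open>P n y - y\<close> equals \<open>P n (y - z) - (y - z)\<close> almost
  everywhere and is at most \<open>(M + 1) * c\<close>. Uniform continuity supplies a piecewise
  constant \<open>z\<close>, so no smoothness of \<open>y\<close> enters.\<close>

lemma P_tendsto_on_continuous:
  assumes "continuous_on {0..1} y" and "e > 0"
  shows "\<forall>\<^sub>F n in sequentially. AE t in unit_lebesgue. \<bar>P n y t - y t\<bar> \<le> e"
proof -
  obtain M where M: "M > 0" "\<And>n x. n \<ge> 1 \<Longrightarrow> x \<in> Linf \<Longrightarrow> Linf_norm (P n x) \<le> M * Linf_norm x"
    by (rule P_bounded) blast
  define c where "c = e / (M + 1)"
  have c: "c > 0" "M * c + c = e"
  proof -
    show "c > 0" using M(1) assms(2) by (simp add: c_def)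
    have "(M + 1) * c = e" using M(1) by (simp add: c_def)
    then show "M * c + c = e" by (simp add: distrib_right)
  qed
  have "uniformly_continuous_on {0..1} y"
    by (intro compact_uniformly_continuous assms) auto
  then obtain d where d: "d > 0"
    "\<And>s t. s \<in> {0..1} \<Longrightarrow> t \<in> {0..1} \<Longrightarrow> \<bar>t - s\<bar> < d \<Longrightarrow> \<bar>y t - y s\<bar> < c"
    using c(1) unfolding uniformly_continuous_on_def dist_real_def by metis
  obtain N where N: "N > 0" "1 / real N < d"
    using d(1) reals_Archimedean[of d] by (metis inverse_eq_divide of_nat_Suc zero_less_Suc)
  show ?thesis
    unfolding eventually_sequentially
  proof (intro exI allI impI)
    fix n assume "N \<le> n"
    have "1 / real n \<le> 1 / real N"
      using N(1) \<open>N \<le> n\<close> by (intro divide_left_mono) auto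
    with N \<open>N \<le> n\<close> have n: "n \<ge> 1" "1 / real n < d"
      by linarith+
    \<comment> \<open>Constants have degree 0 and are therefore admissible for every
      \<open>r\<close>.\<close>
    define z where "z = piecewise n (\<lambda>j. poly [:y (mesh_point n j):])"
    have z: "z \<in> pp_space r n"
      unfolding z_def by (intro piecewise_poly_pp_space n) auto
    then have zL: "z \<in> Linf" by (simp add: pp_space_def)
    have yL: "y \<in> Linf" by (rule continuous_imp_Linf[OF assms(1)])
    have le: "AE t in unit_lebesgue. \<bar>y t - z t\<bar> \<le> c"
      using AE_unit_neq[of 0] AE_space
    proof eventually_elim
      case (elim t)
      then have t: "t \<in> {0<..1}" "t \<in> {0..1}" by auto
      define j where "j = mesh_index n t"
      have j: "j \<in> {1..n}" "t \<in> mesh_interval n j"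
        using mesh_index_works[OF n(1) t(1)] by (auto simp: j_def)
      then have "mesh_point n j \<in> {0..1}"
        by (auto simp: mesh_point_def)
      moreover have "\<bar>t - mesh_point n j\<bar> \<le> 1 / real n"
        using j by (auto simp: mesh_interval_def mesh_point_def of_nat_diff diff_divide_distrib)
      ultimately have "\<bar>y t - y (mesh_point n j)\<bar> < c"
        using n(2) by (intro d t) auto
      then show ?case by (simp add: z_def piecewise_def j_def)
    qed
    have "Linf_norm (\<lambda>t. y t - z t) \<le> c"
      by (rule Linf_norm_le[OF Linf_measurable le]) (intro Linf_diff yL zL)
    then have "M * Linf_norm (\<lambda>t. y t - z t) \<le> M * c"
      using M(1) by simp
    with M(2)[OF n(1) Linf_diff[OF yL zL]]
    have Pd: "Linf_norm (P n (\<lambda>t. y t - z t)) \<le> M * c" by linarith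
    from AE_Linf_norm[OF P_Linf[OF n(1) Linf_diff[OF yL zL]]]
      P_diff[OF n(1) yL zL] P_pp_space[OF n(1) z] le
    show "AE t in unit_lebesgue. \<bar>P n y t - y t\<bar> \<le> e"
      by eventually_elim (use c(2) Pd in linarith)
  qed
qed

end

section \<open>Stability of the collocation equation\<close>

locale collocation = continuous_kernel \<kappa> + projections r P
  for \<kappa> :: "real \<Rightarrow> real \<Rightarrow> real" and r P

text \<open>Lets the stability proof divide a counterexample by its norm. Homogeneity of the
  integral operator is available only on the unit interval, hence the passage through
  \<open>P_cong_AE\<close>.\<close>

lemma (in collocation) P_fredholm_scale:
  assumes "n \<ge> 1" and "x \<in> Linf"
  shows "AE t in unit_lebesgue.
    P n (fredholm_op \<kappa> (\<lambda>u. a * x u)) t = a * P n (fredholm_op \<kappa> x) t"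
proof -
  have ax: "(\<lambda>u. a * x u) \<in> Linf"
    using Linf_lincomb[OF assms(2,2), of a 0] by simp
  have K: "fredholm_op \<kappa> x \<in> Linf" "fredholm_op \<kappa> (\<lambda>u. a * x u) \<in> Linf"
    using assms(2) ax by (auto intro!: continuous_imp_Linf continuous_fredholm)
  have aK: "(\<lambda>u. a * fredholm_op \<kappa> x u) \<in> Linf"
    using Linf_lincomb[OF K(1,1), of a 0] by simp
  have "AE t in unit_lebesgue. fredholm_op \<kappa> (\<lambda>u. a * x u) t = a * fredholm_op \<kappa> x t"
    using fredholm_lincomb[OF _ assms(2,2), of _ a 0] by (intro AE_I2) auto
  from P_cong_AE[OF assms(1) K(2) aK this] P_lincomb[OF assms(1) K(1,1), of a 0]
  show ?thesis by eventually_elim simp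
qed

text \<open>A sequence violating the estimate would, by Arzela--Ascoli applied to its images under the
  integral operator, have a subsequence converging to an eigenfunction.\<close>

theorem (in collocation) stability:
  assumes "\<not> fredholm_eigenvalue \<kappa> 1"
  obtains C N where "C > 0" and "N \<ge> 1" and "\<And>n x. n \<ge> N \<Longrightarrow> x \<in> Linf \<Longrightarrow>
    Linf_norm x \<le> C * Linf_norm (\<lambda>t. x t - P n (fredholm_op \<kappa> x) t)"
proof (rule ccontr)
  assume "\<not> thesis"
  \<comment> \<open>Both the constant and the threshold are tested at \<open>Suc m\<close>: this
    forces the relative residuals to 0 and the mesh indices to infinity.\<close>
  then have "\<not> (\<forall>n\<ge>Suc m. \<forall>x\<in>Linf. Linf_norm x \<le> real (Suc m) * Linf_norm (\<lambda>t. x t - P n (fredholm_op \<kappa> x) t))" for m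
    using that[of "real (Suc m)" "Suc m"] by auto
  then have "\<forall>m. \<exists>n x. n \<ge> Suc m \<and> x \<in> Linf \<and>
      real (Suc m) * Linf_norm (\<lambda>t. x t - P n (fredholm_op \<kappa> x) t) < Linf_norm x"
    by (meson not_le)
  then obtain n x where n: "\<And>m. n m \<ge> Suc m" and x: "\<And>m. x m \<in> Linf"
    and bad: "\<And>m. real (Suc m) * Linf_norm (\<lambda>t. x m t - P (n m) (fredholm_op \<kappa> (x m)) t) < Linf_norm (x m)"
    by metis
  have n1: "n m \<ge> 1" for m using n[of m] by simp
  have K: "fredholm_op \<kappa> y \<in> Linf" if "y \<in> Linf" for y
    by (intro continuous_imp_Linf continuous_fredholm that)
  have res: "(\<lambda>t. y t - P (n m) (fredholm_op \<kappa> y) t) \<in> Linf" if "y \<in> Linf" for y m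
    by (intro Linf_diff P_Linf n1 K that)
  define a where "a m = Linf_norm (x m)" for m
  have a: "a m > 0" for m
    using le_less_trans[OF mult_nonneg_nonneg bad[of m]] Linf_norm_nonneg[OF res[OF x]]
    by (simp add: a_def)
  define u where "u m t = (1 / a m) * x m t" for m t
  have u: "u m \<in> Linf" for m
    using Linf_lincomb[OF x[of m] x[of m], of "1 / a m" 0] unfolding u_def[abs_def] by simp
  have u_le: "AE t in unit_lebesgue. \<bar>u m t\<bar> \<le> 1" for m
    using AE_Linf_norm[OF x[of m]] a[of m]
    by (auto simp: u_def abs_mult a_def elim!: eventually_mono)
  have u_res: "AE t in unit_lebesgue. \<bar>u m t - P (n m) (fredholm_op \<kappa> (u m)) t\<bar> \<le> 1 / real (Suc m)" for m
    using AE_Linf_norm[OF res[OF x], of m m] P_fredholm_scale[OF n1[of m] x[of m], of "1 / a m"]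
  proof eventually_elim
    case (elim t)
    have "u m t - P (n m) (fredholm_op \<kappa> (u m)) t = (1 / a m) * (x m t - P (n m) (fredholm_op \<kappa> (x m)) t)"
      using elim(2) by (simp add: u_def[abs_def] right_diff_distrib)
    then have "\<bar>u m t - P (n m) (fredholm_op \<kappa> (u m)) t\<bar> = \<bar>x m t - P (n m) (fredholm_op \<kappa> (x m)) t\<bar> / a m"
      using a[of m] by (simp add: abs_mult)
    also have "\<dots> \<le> (a m / real (Suc m)) / a m"
    proof (intro divide_right_mono)
      have "Linf_norm (\<lambda>t. x m t - P (n m) (fredholm_op \<kappa> (x m)) t) \<le> a m / real (Suc m)"
        using bad[of m] by (simp add: a_def field_simps)
      with elim(1) show "\<bar>x m t - P (n m) (fredholm_op \<kappa> (x m)) t\<bar> \<le> a m / real (Suc m)"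
        by linarith
    qed (use a[of m] in simp)
    also have "\<dots> = 1 / real (Suc m)" using a[of m] by simp
    finally show ?case .
  qed
  \<comment> \<open>Norm one in the form in which it is contradicted at the end: no
    almost-everywhere bound on \<open>u m\<close> is below 1.\<close>
  have u_norm: "c \<ge> 1" if "AE t in unit_lebesgue. \<bar>u m t\<bar> \<le> c" for c m
  proof -
    have "AE t in unit_lebesgue. \<bar>x m t\<bar> \<le> a m * c"
      using that a[of m] by (auto simp: u_def abs_mult field_simps elim!: eventually_mono)
    then have "a m \<le> a m * c"
      unfolding a_def by (rule Linf_norm_le[OF Linf_measurable[OF x]])
    then show ?thesis using a[of m] by simp
  qed

  obtain B where B: "B > 0" "\<And>s t. s \<in> {0..1} \<Longrightarrow> t \<in> {0..1} \<Longrightarrow> \<bar>\<kappa> s t\<bar> \<le> B"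
    by (rule bounded) blast
  have Ku_le: "\<bar>fredholm_op \<kappa> (u m) s\<bar> \<le> B * 1" if "s \<in> {0..1}" for m s
    by (intro abs_fredholm_le u u_le B that)
  obtain g k where g: "continuous_on {0..1} g" and k: "strict_mono (k :: nat \<Rightarrow> nat)"
    and lim: "\<And>e. 0 < e \<Longrightarrow> \<exists>N. \<forall>m t. m \<ge> N \<and> t \<in> {0..1} \<longrightarrow> norm (fredholm_op \<kappa> (u (k m)) t - g t) < e"
  proof (rule Arzela_Ascoli[of "{0..1::real}" "\<lambda>m. fredholm_op \<kappa> (u m)" B])
    show "norm (fredholm_op \<kappa> (u m) s) \<le> B" if "s \<in> {0..1}" for m s
      using Ku_le[OF that] by simp
    show "\<exists>d>0. \<forall>m s'. s' \<in> {0..1} \<and> norm (s - s') < d \<longrightarrow>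
        norm (fredholm_op \<kappa> (u m) s - fredholm_op \<kappa> (u m) s') < e" if s: "s \<in> {0..1}" and e: "0 < e" for s e
    proof -
      obtain d where "d > 0" and "\<And>x s s'. x \<in> Linf \<Longrightarrow> AE t in unit_lebesgue. \<bar>x t\<bar> \<le> 1 \<Longrightarrow>
          s \<in> {0..1} \<Longrightarrow> s' \<in> {0..1} \<Longrightarrow> \<bar>s - s'\<bar> < d \<Longrightarrow> \<bar>fredholm_op \<kappa> x s - fredholm_op \<kappa> x s'\<bar> < e"
        by (rule fredholm_equicontinuous[OF e, of 1]) blast
      then show ?thesis using s u u_le by (intro exI[of _ d]) auto
    qed
  qed auto
  have gL: "g \<in> Linf" by (rule continuous_imp_Linf[OF g])
  obtain M where M: "M > 0" "\<And>n x. n \<ge> 1 \<Longrightarrow> x \<in> Linf \<Longrightarrow> Linf_norm (P n x) \<le> M * Linf_norm x"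
    by (rule P_bounded) blast
  have nk: "filterlim (\<lambda>m. n (k m)) at_top sequentially"
  proof (rule filterlim_at_top_mono[OF filterlim_ident])
    show "\<forall>\<^sub>F m in sequentially. m \<le> n (k m)"
      using n seq_suble[OF k] by (intro always_eventually allI) (meson Suc_leD le_trans)
  qed
  \<comment> \<open>Along the subsequence, \<open>u - g\<close> is the residual of \<open>u\<close>,
    plus the projection of \<open>fredholm_op \<kappa> u - g\<close>, plus \<open>P g - g\<close>.
    Each part is at most \<open>e / 3\<close>, which turns uniform convergence of the images into
    convergence of \<open>u\<close> itself.\<close>
  have conv: "\<forall>\<^sub>F m in sequentially. (AE t in unit_lebesgue. \<bar>u (k m) t - g t\<bar> \<le> e) \<and>
      (\<forall>t\<in>{0..1}. \<bar>fredholm_op \<kappa> (u (k m)) t - g t\<bar> \<le> e)" if e: "e > 0" for e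
  proof -
    \<comment> \<open>The second entry absorbs the norm of the projection; the first serves the
      pointwise claim on the images.\<close>
    define c where "c = min e (e / (3 * M))"
    have c: "c > 0" "c \<le> e" "M * c \<le> e / 3"
    proof -
      show "c > 0" "c \<le> e" using e M(1) by (auto simp: c_def)
      have "c \<le> e / (3 * M)" by (simp add: c_def)
      then have "M * c \<le> M * (e / (3 * M))" using M(1) by (intro mult_left_mono) auto
      then show "M * c \<le> e / 3" using M(1) by simp
    qed
    obtain N where "\<And>m t. m \<ge> N \<Longrightarrow> t \<in> {0..1} \<Longrightarrow> norm (fredholm_op \<kappa> (u (k m)) t - g t) < c"
      using lim[OF c(1)] by blast
    then have ev1: "\<forall>\<^sub>F m in sequentially. \<forall>t\<in>{0..1}. \<bar>fredholm_op \<kappa> (u (k m)) t - g t\<bar> \<le> c"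
      unfolding eventually_sequentially real_norm_def by (meson less_imp_le)
    have ev2: "\<forall>\<^sub>F m in sequentially. AE t in unit_lebesgue. \<bar>P (n (k m)) g t - g t\<bar> \<le> e / 3"
      by (rule eventually_compose_filterlim[OF P_tendsto_on_continuous[OF g] nk]) (use e in simp)
    have ev3: "\<forall>\<^sub>F m in sequentially. 1 / real (Suc m) \<le> e / 3"
      using order_tendstoD(2)[OF LIMSEQ_inverse_real_of_nat, of "e / 3"] e
      by (auto simp: inverse_eq_divide elim!: eventually_mono)
    show ?thesis
      using ev1 ev2 ev3
    proof eventually_elim
      case (elim m)
      let ?K = "fredholm_op \<kappa> (u (k m))"
      have d: "(\<lambda>t. ?K t - g t) \<in> Linf"
        by (intro Linf_diff K u gL)
      have "Linf_norm (\<lambda>t. ?K t - g t) \<le> c"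
        using elim(1) by (intro Linf_norm_le_everywhere Linf_measurable d) auto
      then have "M * Linf_norm (\<lambda>t. ?K t - g t) \<le> M * c"
        using M(1) by simp
      with M(2)[OF n1 d] c(3) have le: "Linf_norm (P (n (k m)) (\<lambda>t. ?K t - g t)) \<le> e / 3"
        by (meson order_trans)
      have "real (Suc m) \<le> real (Suc (k m))"
        using seq_suble[OF k, of m] by simp
      then have "1 / real (Suc (k m)) \<le> 1 / real (Suc m)"
        by (intro divide_left_mono) auto
      with elim(3) have le': "1 / real (Suc (k m)) \<le> e / 3" by linarith
      have "AE t in unit_lebesgue. \<bar>u (k m) t - g t\<bar> \<le> e"
        using AE_Linf_norm[OF P_Linf[OF n1 d], of "k m"] P_diff[OF n1 K[OF u] gL, of "k m" "k m"] elim(2) u_res[of "k m"]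
        by eventually_elim (use le le' in linarith)
      then show ?case using elim(1) c(2) by force
    qed
  qed
  have eig: "fredholm_op \<kappa> g s = g s" if s: "s \<in> {0..1}" for s
  proof (rule ccontr)
    assume "fredholm_op \<kappa> g s \<noteq> g s"
    then have pos: "\<bar>fredholm_op \<kappa> g s - g s\<bar> > 0" by simp
    \<comment> \<open>Passing through \<open>u (k m)\<close> bounds the defect of \<open>g\<close>
      at \<open>s\<close> by \<open>B * e + e\<close>; the halving makes this strictly smaller than
      the defect.\<close>
    define e where "e = \<bar>fredholm_op \<kappa> g s - g s\<bar> / 2 / (B + 1)"
    have "(B + 1) * e = \<bar>fredholm_op \<kappa> g s - g s\<bar> / 2"
    proof -
      have "b * (a / b) = a" if "b > 0" for a b :: real using that by simp
      then show ?thesis unfolding e_def by this (use B(1) in simp)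
    qed
    then have e: "e > 0" "(B + 1) * e < \<bar>fredholm_op \<kappa> g s - g s\<bar>"
      using pos B(1) by (auto simp: e_def)
    obtain m where m: "AE t in unit_lebesgue. \<bar>u (k m) t - g t\<bar> \<le> e"
      "\<bar>fredholm_op \<kappa> (u (k m)) s - g s\<bar> \<le> e"
      using eventually_happens'[OF sequentially_bot conv[OF e(1)]] s by blast
    have "\<bar>fredholm_op \<kappa> (\<lambda>t. 1 * u (k m) t + (-1) * g t) s\<bar> \<le> B * e"
      using m(1) Linf_diff[OF u gL] by (intro abs_fredholm_le s B) auto
    then have "\<bar>fredholm_op \<kappa> (u (k m)) s - fredholm_op \<kappa> g s\<bar> \<le> B * e"
      by (simp only: fredholm_lincomb[OF s u gL])
    with m(2) e(2) show False by (simp add: algebra_simps)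
  qed
  have "AE t in unit_lebesgue. g t = 0"
  proof (rule ccontr)
    assume "\<not> (AE t in unit_lebesgue. g t = 0)"
    then have "fredholm_eigenvalue \<kappa> 1"
      unfolding fredholm_eigenvalue_def using eig gL by (intro bexI[of _ g]) (auto intro!: AE_I2)
    with assms show False by simp
  qed
  moreover obtain m where "AE t in unit_lebesgue. \<bar>u (k m) t - g t\<bar> \<le> 1 / 2"
    using eventually_happens'[OF sequentially_bot conv[of "1 / 2"]] by auto
  ultimately have "AE t in unit_lebesgue. \<bar>u (k m) t\<bar> \<le> 1 / 2"
    by eventually_elim simp
  from u_norm[OF this] show False by simp
qed

section \<open>Existence and uniqueness of the collocation solution\<close>

text \<open>Gaussian elimination, by induction on the set of unknowns; matrix, rows and right-hand
  side all change in a step and are therefore generalised.\<close>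

lemma square_system_solvable:
  fixes A :: "'i \<Rightarrow> 'j \<Rightarrow> real"
  assumes "finite S" and "finite R" and "card R = card S"
    and "\<And>c. (\<And>i. i \<in> R \<Longrightarrow> (\<Sum>l\<in>S. A i l * c l) = 0) \<Longrightarrow> (\<And>l. l \<in> S \<Longrightarrow> c l = 0)"
  shows "\<exists>c. \<forall>i\<in>R. (\<Sum>l\<in>S. A i l * c l) = b i"
  using assms
proof (induction S arbitrary: R A b rule: finite_induct)
  case empty
  then show ?case by simp
next
  case (insert l0 S)
  have "\<exists>i0\<in>R. A i0 l0 \<noteq> 0"
  proof (rule ccontr)
    assume "\<not> ?thesis"
    then have z: "A i l0 = 0" if "i \<in> R" for i using that by blast
    \<comment> \<open>Without a pivot in column \<open>l0\<close> the unit vector at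
      \<open>l0\<close> would lie in the kernel.\<close>
    have "(\<Sum>l\<in>insert l0 S. A i l * (if l = l0 then 1 else 0)) = 0" if "i \<in> R" for i
      using insert.hyps z[OF that] by (simp add: sum.If_cases if_distrib cong: if_cong)
    from insert.prems(3)[OF this, of l0] show False by simp
  qed
  then obtain i0 where i0: "i0 \<in> R" "A i0 l0 \<noteq> 0" by blast
  define R' where "R' = R - {i0}"
  \<comment> \<open>The Schur complement of the pivot; its row \<open>i0\<close> vanishes.\<close>
  define A' where "A' i l = A i l - A i l0 / A i0 l0 * A i0 l" for i l
  \<comment> \<open>The value at \<open>l0\<close> is chosen so that row \<open>i0\<close> evaluates
    to \<open>y\<close>. With \<open>y = 0\<close> this transfers injectivity to the smaller system,
    with \<open>y = b i0\<close> it lifts the solution back.\<close>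
  define ext where "ext y c = (\<lambda>l. if l = l0 then (y - (\<Sum>l\<in>S. A i0 l * c l)) / A i0 l0 else c l)" for y c
  have ext_sum: "(\<Sum>l\<in>insert l0 S. A i l * ext y c l)
      = A i l0 / A i0 l0 * y + (\<Sum>l\<in>S. A' i l * c l)" for i y c
  proof -
    have "(\<Sum>l\<in>insert l0 S. A i l * ext y c l) = A i l0 * ext y c l0 + (\<Sum>l\<in>S. A i l * ext y c l)"
      using insert.hyps by simp
    also have "(\<Sum>l\<in>S. A i l * ext y c l) = (\<Sum>l\<in>S. A i l * c l)"
      using insert.hyps by (intro sum.cong) (auto simp: ext_def)
    also have "A i l0 * ext y c l0 = A i l0 / A i0 l0 * y - A i l0 / A i0 l0 * (\<Sum>l\<in>S. A i0 l * c l)"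
      by (simp add: ext_def right_diff_distrib diff_divide_distrib)
    finally show ?thesis
      by (simp add: A'_def left_diff_distrib sum_subtractf sum_distrib_left mult.assoc)
  qed
  have A'_i0: "(\<Sum>l\<in>S. A' i0 l * c l) = 0" for c
    using i0(2) by (intro sum.neutral) (simp add: A'_def)
  have "\<exists>c. \<forall>i\<in>R'. (\<Sum>l\<in>S. A' i l * c l) = b i - A i l0 / A i0 l0 * b i0"
  proof (rule insert.IH)
    show "finite R'" "card R' = card S"
      using insert.prems insert.hyps i0(1) by (auto simp: R'_def)
    fix c l
    assume c: "\<And>i. i \<in> R' \<Longrightarrow> (\<Sum>l\<in>S. A' i l * c l) = 0" and l: "l \<in> S"
    have "(\<Sum>l\<in>insert l0 S. A i l * ext 0 c l) = 0" if "i \<in> R" for i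
      using c[of i] A'_i0[of c] that unfolding ext_sum by (cases "i = i0") (auto simp: R'_def)
    from insert.prems(3)[OF this, of l] l insert.hyps(2) show "c l = 0"
      by (auto simp: ext_def split: if_splits)
  qed
  then obtain c where c: "\<And>i. i \<in> R' \<Longrightarrow> (\<Sum>l\<in>S. A' i l * c l) = b i - A i l0 / A i0 l0 * b i0"
    by blast
  have "(\<Sum>l\<in>insert l0 S. A i l * ext (b i0) c l) = b i" if "i \<in> R" for i
    using c[of i] A'_i0[of c] that i0(2) unfolding ext_sum by (cases "i = i0") (auto simp: R'_def)
  then show ?case by blast
qed

section \<open>Lagrange interpolation at reference nodes\<close>

definition lagrange_poly :: "(nat \<Rightarrow> 'a::field) \<Rightarrow> nat \<Rightarrow> nat \<Rightarrow> 'a poly" where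
  "lagrange_poly \<xi> m k = (\<Prod>i\<in>{..m} - {k}. smult (1 / (\<xi> k - \<xi> i)) [:- \<xi> i, 1:])"

lemma degree_lagrange_poly:
  assumes "k \<le> m"
  shows "degree (lagrange_poly \<xi> m k) \<le> m"
proof -
  have "degree (lagrange_poly \<xi> m k) \<le> (\<Sum>i\<in>{..m} - {k}. degree (smult (1 / (\<xi> k - \<xi> i)) [:- \<xi> i, 1:]))"
    unfolding lagrange_poly_def by (rule degree_prod_sum_le[unfolded o_def]) simp
  also have "\<dots> \<le> (\<Sum>i\<in>{..m} - {k}. 1)"
    by (intro sum_mono order_trans[OF degree_smult_le]) simp
  also have "\<dots> = m" using assms by simp
  finally show ?thesis .
qed

lemma poly_lagrange_poly_node:
  assumes "inj_on \<xi> {..m}" and "k \<le> m" and "l \<le> m"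
  shows "poly (lagrange_poly \<xi> m k) (\<xi> l) = (if l = k then 1 else 0)"
proof (cases "l = k")
  case True
  have "poly (lagrange_poly \<xi> m k) (\<xi> k) = (\<Prod>i\<in>{..m} - {k}. 1)"
    unfolding lagrange_poly_def poly_prod
    using assms by (intro prod.cong) (auto dest: inj_onD simp flip: diff_divide_distrib)
  with True show ?thesis by simp
next
  case False
  then show ?thesis
    unfolding lagrange_poly_def poly_prod
    using assms(3) by (auto intro!: prod_zero bexI[of _ l])
qed

lemma lagrange_expansion:
  assumes "inj_on \<xi> {..m}" and "degree p \<le> m"
  shows "poly p u = (\<Sum>k\<le>m. poly p (\<xi> k) * poly (lagrange_poly \<xi> m k) u)"
proof -
  define q where "q = (\<Sum>k\<le>m. smult (poly p (\<xi> k)) (lagrange_poly \<xi> m k))"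
  have "p = q"
  proof (rule poly_eqI_degree[of "\<xi> ` {..m}"])
    show "poly p x = poly q x" if x: "x \<in> \<xi> ` {..m}" for x
    proof -
      obtain l where l: "l \<le> m" "x = \<xi> l" using x by auto
      have "poly q x = (\<Sum>k\<le>m. poly p (\<xi> k) * (if l = k then 1 else 0))"
        unfolding q_def l poly_sum poly_smult
        using poly_lagrange_poly_node[OF assms(1) _ l(1)] by (intro sum.cong) auto
      also have "\<dots> = poly p x"
        using l by (simp add: if_distrib cong: if_cong)
      finally show ?thesis by simp
    qed
    have "degree q \<le> m"
      unfolding q_def
      by (intro degree_sum_le order_trans[OF degree_smult_le] degree_lagrange_poly) auto
    then show "degree q < card (\<xi> ` {..m})" "degree p < card (\<xi> ` {..m})"
      using assms by (auto simp: card_image)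
  qed
  then show ?thesis by (metis (no_types, lifting) q_def poly_smult poly_sum sum.cong)
qed

text \<open>The collocation points of every mesh interval are affine images of these points of
  \<open>[-1/2, 1/2]\<close>; for \<open>r = 0\<close> the division by zero yields the midpoint \<open>0\<close>.\<close>

definition ref_node :: "nat \<Rightarrow> nat \<Rightarrow> real" where
  "ref_node r k = (real k - real r) / (2 * real r)"

definition mesh_mid :: "nat \<Rightarrow> nat \<Rightarrow> real" where
  "mesh_mid n j = (real j - 1 / 2) / real n"

lemma inj_ref_node: "inj_on (ref_node r) {..2 * r}"
  by (cases "r = 0") (auto simp: ref_node_def inj_on_def)

lemma ref_node_reflect: "k \<le> 2 * r \<Longrightarrow> ref_node r (2 * r - k) = - ref_node r k"
  by (simp add: ref_node_def of_nat_diff minus_divide_left)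

lemma abs_ref_node_le: 
  assumes "k \<le> 2 * r"
  shows "\<bar>ref_node r k\<bar> \<le> 1 / 2"
proof (cases "r = 0")
  case False
  have "\<bar>real k - real r\<bar> \<le> real r" using assms by linarith
  then show ?thesis using False by (simp add: ref_node_def abs_divide field_simps)
qed (simp add: ref_node_def)

lemma colloc_point_eq:
  assumes "j \<ge> 1"
  shows "colloc_point r n j k = mesh_mid n j + (1 / real n) * ref_node r k"
proof -
  have "mesh_point n (j - 1) = (real j - 1) / real n"
    using assms by (simp add: mesh_point_def of_nat_diff)
  then show ?thesis
    by (cases "r = 0"; cases "n = 0")
       (auto simp: colloc_point_def mesh_mid_def ref_node_def mesh_point_def field_simps)
qed

lemma mesh_interval_eq:
  assumes "j \<ge> 1"
  shows "mesh_interval n j = {mesh_mid n j - (1 / 2) * (1 / real n) .. mesh_mid n j + (1 / 2) * (1 / real n)}"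
  using assms by (cases "n = 0")
    (auto simp: mesh_interval_def mesh_mid_def mesh_point_def of_nat_diff field_simps)

abbreviation ref_lagrange :: "nat \<Rightarrow> nat \<Rightarrow> real poly" where
  "ref_lagrange r \<equiv> lagrange_poly (ref_node r) (2 * r)"

text \<open>The affine map from the mesh interval to [-1/2, 1/2] carries collocation points to
  reference nodes, so one family of cardinal polynomials serves every interval.\<close>

lemma poly_eq_ref_lagrange:
  assumes "n \<ge> 1" and "j \<ge> 1" and "degree p \<le> 2 * r"
  shows "poly p t = (\<Sum>k\<le>2 * r. poly p (colloc_point r n j k) *
           poly (ref_lagrange r k) (real n * (t - mesh_mid n j)))"
proof -
  define q where "q = pcompose p [:mesh_mid n j, 1 / real n:]"
  have "degree q \<le> 2 * r"
    using assms(1,3) by (simp add: q_def degree_pcompose)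
  from lagrange_expansion[OF inj_ref_node this, of "real n * (t - mesh_mid n j)"]
  show ?thesis
    using assms(1) by (simp add: q_def poly_pcompose colloc_point_eq[OF assms(2)] mult.commute)
qed

text \<open>The Lebesgue function is continuous on a compact interval, hence bounded. The bound
  depends on \<open>r\<close> alone, which is why the interpolation constants are independent of the
  mesh.\<close>

lemma lebesgue_constant:
  obtains \<Lambda> where "\<Lambda> > 0" and "\<And>q u c. degree q \<le> 2 * r \<Longrightarrow> \<bar>u\<bar> \<le> 1 / 2 \<Longrightarrow>
    (\<And>k. k \<le> 2 * r \<Longrightarrow> \<bar>poly q (ref_node r k)\<bar> \<le> c) \<Longrightarrow> \<bar>poly q u\<bar> \<le> \<Lambda> * c"
proof -
  have "continuous_on {-1/2..1/2} (\<lambda>u. \<Sum>k\<le>2 * r. \<bar>poly (ref_lagrange r k) u\<bar>)"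
    by (intro continuous_intros)
  from compact_imp_bounded[OF compact_continuous_image[OF this]]
  obtain \<Lambda> where L: "\<Lambda> > 0"
    "\<And>u. u \<in> {-1/2..1/2} \<Longrightarrow> norm (\<Sum>k\<le>2 * r. \<bar>poly (ref_lagrange r k) u\<bar>) \<le> \<Lambda>"
    by (auto simp: bounded_pos)
  show thesis
  proof (rule that[OF L(1)])
    fix q :: "real poly" and u c :: real
    assume q: "degree q \<le> 2 * r" and u: "\<bar>u\<bar> \<le> 1 / 2"
      and c: "\<And>k. k \<le> 2 * r \<Longrightarrow> \<bar>poly q (ref_node r k)\<bar> \<le> c"
    have "0 \<le> c" using c[of 0] by simp
    have "\<bar>poly q u\<bar> \<le> (\<Sum>k\<le>2 * r. \<bar>poly q (ref_node r k) * poly (ref_lagrange r k) u\<bar>)"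
      unfolding lagrange_expansion[OF inj_ref_node q, of u] by (rule sum_abs)
    also have "\<dots> \<le> (\<Sum>k\<le>2 * r. c * \<bar>poly (ref_lagrange r k) u\<bar>)"
      unfolding abs_mult by (intro sum_mono mult_right_mono c) auto
    also have "\<dots> = c * (\<Sum>k\<le>2 * r. \<bar>poly (ref_lagrange r k) u\<bar>)"
      by (simp add: sum_distrib_left)
    also have "\<dots> \<le> c * \<Lambda>"
    proof (rule mult_left_mono)
      have "u \<in> {-1/2..1/2}" using u by (auto simp: abs_le_iff)
      from L(2)[OF this] show "(\<Sum>k\<le>2 * r. \<bar>poly (ref_lagrange r k) u\<bar>) \<le> \<Lambda>"
        unfolding real_norm_def by (rule order_trans[OF abs_ge_self])
    qed fact
    finally show "\<bar>poly q u\<bar> \<le> \<Lambda> * c" by (simp add: mult.commute)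
  qed
qed

text \<open>The cardinal functions of the piecewise polynomial space. For \<open>r \<ge> 1\<close> a
  mesh point shared by two intervals is a node of both; indexing by pairs gives it one basis
  function from each side, in line with the absence of matching conditions.\<close>

definition colloc_basis :: "nat \<Rightarrow> nat \<Rightarrow> nat \<times> nat \<Rightarrow> real \<Rightarrow> real" where
  "colloc_basis r n i = piecewise n (\<lambda>j. poly (if j = fst i
     then pcompose (ref_lagrange r (snd i)) [:- real n * mesh_mid n j, real n:] else 0))"

abbreviation colloc_nodes :: "nat \<Rightarrow> nat \<Rightarrow> (nat \<times> nat) set" where
  "colloc_nodes r n \<equiv> {1..n} \<times> {..2 * r}"

abbreviation node :: "nat \<Rightarrow> nat \<Rightarrow> nat \<times> nat \<Rightarrow> real" where
  "node r n i \<equiv> colloc_point r n (fst i) (snd i)"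

lemma colloc_basis_Linf:
  assumes "n \<ge> 1" and "i \<in> colloc_nodes r n"
  shows "colloc_basis r n i \<in> Linf"
proof -
  have "degree (pcompose (ref_lagrange r (snd i)) [:- real n * mesh_mid n j, real n:]) \<le> 2 * r" for j
    using assms degree_lagrange_poly[of "snd i" "2 * r" "ref_node r"] by (auto simp: degree_pcompose)
  then have "colloc_basis r n i \<in> pp_space r n"
    unfolding colloc_basis_def by (intro piecewise_poly_pp_space assms) auto
  then show ?thesis by (simp add: pp_space_def)
qed

lemma colloc_point_in_unit:
  assumes "i \<in> colloc_nodes r n"
  shows "node r n i \<in> {0..1}"
proof -
  have i: "1 \<le> fst i" "fst i \<le> n" "snd i \<le> 2 * r" using assms by auto
  then have "(1 / real n) * \<bar>ref_node r (snd i)\<bar> \<le> (1 / real n) * (1 / 2)"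
    using abs_ref_node_le[of "snd i" r] by (intro mult_left_mono) auto
  then have "\<bar>(1 / real n) * ref_node r (snd i)\<bar> \<le> 1 / 2 * (1 / real n)"
    by (simp add: abs_mult)
  then have "node r n i \<in> mesh_interval n (fst i)"
    unfolding colloc_point_eq[OF i(1)] mesh_interval_eq[OF i(1)] atLeastAtMost_iff abs_le_iff
    by linarith
  then show ?thesis
    using mesh_interval_subset[of "fst i" n] i by auto
qed

lemma sum_colloc_basis_Linf:
  assumes "n \<ge> 1"
  shows "(\<lambda>t. \<Sum>i\<in>colloc_nodes r n. v i * colloc_basis r n i t) \<in> Linf"
proof -
  have "(\<lambda>t. \<Sum>i\<in>A. v i * colloc_basis r n i t) \<in> Linf" if "finite A" "A \<subseteq> colloc_nodes r n" for A
    using that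
  proof (induction A rule: finite_induct)
    case empty
    then show ?case using continuous_imp_Linf[of "\<lambda>_. 0"] by simp
  next
    case (insert i A)
    then show ?case
      using Linf_lincomb[OF colloc_basis_Linf[OF assms, of i r], of _ "v i" 1] by simp
  qed
  then show ?thesis by simp
qed

lemma (in continuous_kernel) fredholm_sum_colloc_basis:
  assumes "n \<ge> 1" and "s \<in> {0..1}"
  shows "fredholm_op \<kappa> (\<lambda>t. \<Sum>i\<in>colloc_nodes r n. v i * colloc_basis r n i t) s
    = (\<Sum>i\<in>colloc_nodes r n. fredholm_op \<kappa> (colloc_basis r n i) s * v i)"
proof -
  have "(\<integral>t. \<kappa> s t * (\<Sum>i\<in>colloc_nodes r n. v i * colloc_basis r n i t) \<partial>unit_lebesgue)
      = (\<integral>t. (\<Sum>i\<in>colloc_nodes r n. (\<kappa> s t * colloc_basis r n i t) * v i) \<partial>unit_lebesgue)"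
    by (simp add: sum_distrib_left mult_ac)
  also have "\<dots> = (\<Sum>i\<in>colloc_nodes r n. \<integral>t. (\<kappa> s t * colloc_basis r n i t) * v i \<partial>unit_lebesgue)"
    by (intro Bochner_Integration.integral_sum integrable_mult_left integrable_kernel_mult
        colloc_basis_Linf assms)
  finally show ?thesis
    by (simp add: fredholm_op_def)
qed

lemma (in projections) P_eq_colloc_basis:
  assumes "n \<ge> 1" and "continuous_on {0..1} x"
  shows "AE t in unit_lebesgue. P n x t = (\<Sum>i\<in>colloc_nodes r n. x (node r n i) * colloc_basis r n i t)"
proof -
  obtain p where deg: "\<And>j. degree (p j) \<le> 2 * r"
    and nodes: "\<And>j k. j \<in> {1..n} \<Longrightarrow> k \<in> {0..2 * r} \<Longrightarrow>
           poly (p j) (colloc_point r n j k) = x (colloc_point r n j k)"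
    and ae: "AE t in unit_lebesgue. P n x t = piecewise n (\<lambda>j. poly (p j)) t"
    by (rule is_pp_interpolantE[OF interpolant[OF assms] assms(1)]) blast
  show ?thesis
    using ae AE_unit_neq[of 0] AE_space
  proof eventually_elim
    case (elim t)
    then have "t \<in> {0<..1}" by auto
    define j where "j = mesh_index n t"
    have j: "j \<in> {1..n}"
      using mesh_index_works(1)[OF assms(1) \<open>t \<in> {0<..1}\<close>] by (simp add: j_def)
    let ?l = "\<lambda>k. poly (ref_lagrange r k) (real n * (t - mesh_mid n j))"
    have "P n x t = (\<Sum>k\<le>2 * r. poly (p j) (colloc_point r n j k) * ?l k)"
      using elim(1) poly_eq_ref_lagrange[OF assms(1) _ deg, of j j t] j
      by (simp add: piecewise_def j_def)
    also have "\<dots> = (\<Sum>k\<le>2 * r. x (colloc_point r n j k) * ?l k)"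
      using nodes[OF j] by (intro sum.cong) auto
    \<comment> \<open>Basis functions of the other intervals vanish at \<open>t\<close>, so the
      local expansion becomes a global one with coefficients independent of
      \<open>t\<close>.\<close>
    also have "\<dots> = (\<Sum>j'\<in>{1..n}. if j' = j then \<Sum>k\<le>2 * r. x (colloc_point r n j k) * ?l k else 0)"
      using j by simp
    also have "\<dots> = (\<Sum>j'\<in>{1..n}. \<Sum>k\<le>2 * r. x (node r n (j', k)) * colloc_basis r n (j', k) t)"
      by (intro sum.cong refl)
         (auto simp: colloc_basis_def piecewise_def j_def[symmetric] poly_pcompose algebra_simps
               intro!: sum.cong)
    also have "\<dots> = (\<Sum>i\<in>colloc_nodes r n. x (node r n i) * colloc_basis r n i t)"
      by (simp add: sum.cartesian_product case_prod_beta)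
    finally show ?case .
  qed
qed

section \<open>Solvability of the collocation equation\<close>

context collocation
begin

text \<open>A solution is \<open>P n\<close> applied to a continuous function, so it is a
  combination \<open>?x v\<close> of the basis functions; the equation then asks that
  \<open>v i\<close> be the value of \<open>fredholm_op \<kappa> (?x v) + f\<close> at node
  \<open>i\<close>. If \<open>v\<close> solves the homogeneous system, \<open>?x v\<close> has zero
  residual and vanishes almost everywhere by \<open>stable\<close>.\<close>

lemma collocation_solution_exists:
  assumes "n \<ge> 1" and f: "continuous_on {0..1} f"
    and stable: "\<And>x. x \<in> Linf \<Longrightarrow> Linf_norm x \<le> C * Linf_norm (\<lambda>t. x t - P n (fredholm_op \<kappa> x) t)"
  shows "\<exists>x. collocation_solution \<kappa> f (P n) x"
proof -
  let ?I = "colloc_nodes r n" and ?e = "colloc_basis r n"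
  let ?x = "\<lambda>v t. \<Sum>i\<in>?I. v i * ?e i t"
  define A where "A i l = (if l = i then 1 else 0) - fredholm_op \<kappa> (?e l) (node r n i)" for i l
  have xL: "?x v \<in> Linf" for v by (rule sum_colloc_basis_Linf[OF assms(1)])
  have A: "(\<Sum>l\<in>?I. A i l * v l) = v i - fredholm_op \<kappa> (?x v) (node r n i)" if i: "i \<in> ?I" for i v
  proof -
    have "(\<Sum>l\<in>?I. A i l * v l)
        = (\<Sum>l\<in>?I. if l = i then v l else 0) - (\<Sum>l\<in>?I. fredholm_op \<kappa> (?e l) (node r n i) * v l)"
      unfolding A_def left_diff_distrib sum_subtractf
      by (simp add: if_distrib[of "\<lambda>z. z * _"] cong: if_cong)
    also have "(\<Sum>l\<in>?I. if l = i then v l else 0) = v i"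
      using i by simp
    finally show ?thesis
      using fredholm_sum_colloc_basis[OF assms(1) colloc_point_in_unit[OF i]] by simp
  qed
  have Px: "AE t in unit_lebesgue. P n y t = ?x v t"
    if "continuous_on {0..1} y" "\<And>i. i \<in> ?I \<Longrightarrow> y (node r n i) = v i" for y v
    using P_eq_colloc_basis[OF assms(1) that(1)]
    by eventually_elim (use that(2) in \<open>auto intro!: sum.cong\<close>)
  have "\<exists>v. \<forall>i\<in>?I. (\<Sum>l\<in>?I. A i l * v l) = f (node r n i)"
  proof (rule square_system_solvable)
    fix v l
    assume v: "\<And>i. i \<in> ?I \<Longrightarrow> (\<Sum>l\<in>?I. A i l * v l) = 0" and l: "l \<in> ?I"
    have Kv: "fredholm_op \<kappa> (?x v) (node r n i) = v i" if "i \<in> ?I" for i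
      using v[OF that] A[OF that] by simp
    let ?d = "\<lambda>t. ?x v t - P n (fredholm_op \<kappa> (?x v)) t"
    have "Linf_norm ?d \<le> 0"
      using Px[OF continuous_fredholm[OF xL] Kv]
      by (intro Linf_norm_le Linf_measurable Linf_diff xL P_Linf assms continuous_imp_Linf
          continuous_fredholm) auto
    moreover have "0 \<le> Linf_norm ?d"
      by (intro Linf_norm_nonneg Linf_diff xL P_Linf assms continuous_imp_Linf continuous_fredholm)
    ultimately have "Linf_norm (?x v) \<le> 0"
      using stable[OF xL, of v] by simp
    then have "AE t in unit_lebesgue. ?x v t = 0"
      using AE_Linf_norm[OF xL, of v] by (auto elim!: eventually_mono)
    \<comment> \<open>Nodal values of \<open>?x v\<close> cannot be read off from an
      almost-everywhere statement; those of its continuous image can, and they equal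
      \<open>v\<close>.\<close>
    then have "fredholm_op \<kappa> (?x v) (node r n l) = fredholm_op \<kappa> (\<lambda>_. 0) (node r n l)"
      by (intro fredholm_cong_AE colloc_point_in_unit xL l continuous_imp_Linf) auto
    then show "v l = 0"
      using Kv[OF l] by (simp add: fredholm_op_def)
  qed auto
  then obtain v where v: "\<And>i. i \<in> ?I \<Longrightarrow> (\<Sum>l\<in>?I. A i l * v l) = f (node r n i)" by blast
  let ?K = "fredholm_op \<kappa> (?x v)"
  have Kc: "continuous_on {0..1} ?K" by (intro continuous_fredholm xL)
  have "AE t in unit_lebesgue. P n (\<lambda>t. ?K t + f t) t = ?x v t"
  proof (rule Px)
    show "?K (node r n i) + f (node r n i) = v i" if "i \<in> ?I" for i
      using v[OF that] A[OF that] by simp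
  qed (intro continuous_intros Kc f)
  moreover have "AE t in unit_lebesgue. P n (\<lambda>t. 1 * ?K t + 1 * f t) t = 1 * P n ?K t + 1 * P n f t"
    by (intro P_lincomb assms continuous_imp_Linf Kc f)
  ultimately have "AE t in unit_lebesgue. ?x v t - P n ?K t = P n f t"
    by eventually_elim simp
  with xL show ?thesis unfolding collocation_solution_def by blast
qed

lemma AE_residual_diff:
  assumes "n \<ge> 1" and "x \<in> Linf" and "y \<in> Linf"
  shows "AE t in unit_lebesgue. (x t - y t) - P n (fredholm_op \<kappa> (\<lambda>t. x t - y t)) t
    = (x t - P n (fredholm_op \<kappa> x) t) - (y t - P n (fredholm_op \<kappa> y) t)"
proof -
  have K: "fredholm_op \<kappa> x \<in> Linf" "fredholm_op \<kappa> y \<in> Linf" "fredholm_op \<kappa> (\<lambda>t. x t - y t) \<in> Linf"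
    by (auto intro!: continuous_imp_Linf[OF continuous_fredholm] Linf_diff[OF assms(2,3)] assms)
  have "AE t in unit_lebesgue. fredholm_op \<kappa> (\<lambda>t. x t - y t) t = fredholm_op \<kappa> x t - fredholm_op \<kappa> y t"
    using fredholm_lincomb[OF _ assms(2,3), of _ 1 "-1"] by (intro AE_I2) auto
  from P_cong_AE[OF assms(1) K(3) Linf_diff[OF K(1,2)] this] P_diff[OF assms(1) K(1,2)]
  show ?thesis by eventually_elim simp
qed

lemma collocation_solution_unique:
  assumes "n \<ge> 1"
    and stable: "\<And>x. x \<in> Linf \<Longrightarrow> Linf_norm x \<le> C * Linf_norm (\<lambda>t. x t - P n (fredholm_op \<kappa> x) t)"
    and "collocation_solution \<kappa> f (P n) x" and "collocation_solution \<kappa> f (P n) y"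
  shows "AE t in unit_lebesgue. y t = x t"
proof -
  have L: "x \<in> Linf" "y \<in> Linf" and sol: "AE t in unit_lebesgue. x t - P n (fredholm_op \<kappa> x) t = P n f t"
    "AE t in unit_lebesgue. y t - P n (fredholm_op \<kappa> y) t = P n f t"
    using assms(3,4) by (auto simp: collocation_solution_def)
  from AE_residual_diff[OF assms(1) L] sol
  have "AE t in unit_lebesgue. \<bar>(x t - y t) - P n (fredholm_op \<kappa> (\<lambda>t. x t - y t)) t\<bar> \<le> 0"
    by eventually_elim simp
  moreover have d: "(\<lambda>t. x t - y t) \<in> Linf" by (intro Linf_diff L)
  moreover have r: "(\<lambda>t. (x t - y t) - P n (fredholm_op \<kappa> (\<lambda>t. x t - y t)) t) \<in> Linf"
    by (intro Linf_diff[OF d] P_Linf assms continuous_imp_Linf continuous_fredholm d)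
  ultimately have "Linf_norm (\<lambda>t. (x t - y t) - P n (fredholm_op \<kappa> (\<lambda>t. x t - y t)) t) = 0"
    by (intro antisym Linf_norm_le Linf_measurable Linf_norm_nonneg)
  with stable[OF d] have "Linf_norm (\<lambda>t. x t - y t) \<le> 0" by simp
  with AE_Linf_norm[OF d] show ?thesis
    by (auto elim!: eventually_mono)
qed

end

section \<open>Error estimates\<close>

lemma Cm_continuous: "Cm m g \<Longrightarrow> continuous_on {0..1} g"
  unfolding Cm_def by (metis continuous_on_cong le0)

text \<open>One constant bounds all derivatives up to order \<open>m\<close>, because the
  interpolation estimate expands to two different orders. The factorial in the remainder is given
  away.\<close>

lemma Cm_Taylor:
  assumes "Cm m g"
  obtains D B where "B > 0" and "\<And>N w z. N < m \<Longrightarrow> w \<in> {0..1} \<Longrightarrow> z \<in> {0..1} \<Longrightarrow>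
    \<bar>g z - (\<Sum>i\<le>N. D i w * (z - w) ^ i / fact i)\<bar> \<le> B * \<bar>z - w\<bar> ^ Suc N"
proof -
  obtain D where D0: "\<And>t. t \<in> {0..1} \<Longrightarrow> D 0 t = g t"
    and D: "\<And>k t. k < m \<Longrightarrow> t \<in> {0..1} \<Longrightarrow> (D k has_real_derivative D (Suc k) t) (at t within {0..1})"
    and cont: "\<And>k. k \<le> m \<Longrightarrow> continuous_on {0..1} (D k)"
    using assms unfolding Cm_def by blast
  have "\<forall>k. \<exists>c. k \<le> m \<longrightarrow> (\<forall>t\<in>{0..1}. \<bar>D k t\<bar> \<le> c)"
    using continuous_bounded_unit[OF cont] by metis
  then obtain c where c: "\<And>k t. k \<le> m \<Longrightarrow> t \<in> {0..1} \<Longrightarrow> \<bar>D k t\<bar> \<le> c k"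
    by metis
  define B where "B = 1 + (\<Sum>k\<le>m. \<bar>c k\<bar>)"
  have "B > 0" unfolding B_def by (intro add_pos_nonneg sum_nonneg) auto
  have B: "\<bar>D k t\<bar> \<le> B" if "k \<le> m" "t \<in> {0..1}" for k t
  proof -
    have "\<bar>D k t\<bar> \<le> \<bar>c k\<bar>" using c[OF that] by simp
    also have "\<dots> \<le> (\<Sum>k\<le>m. \<bar>c k\<bar>)" using that by (intro member_le_sum) auto
    finally show ?thesis by (simp add: B_def)
  qed
  show thesis
  proof (rule that[OF \<open>B > 0\<close>])
    fix N w z
    assume N: "N < m" and w: "w \<in> {0..1::real}" and z: "z \<in> {0..1::real}"
    have "norm (D 0 z - (\<Sum>i\<le>N. D i w * (z - w) ^ i / fact i)) \<le> B * norm (z - w) ^ Suc N / fact N"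
    proof (rule field_Taylor[of "{0..1}"])
      show "(D i has_real_derivative D (Suc i) t) (at t within {0..1})" if "t \<in> {0..1}" "i \<le> N" for i t
        using D[OF _ that(1)] that(2) N by simp
      show "norm (D (Suc N) t) \<le> B" if "t \<in> {0..1}" for t
        using B[OF _ that] N by simp
    qed (use w z in auto)
    also have "\<dots> \<le> B * norm (z - w) ^ Suc N / 1"
      using \<open>B > 0\<close> by (intro divide_left_mono) (auto simp: fact_ge_1)
    finally show "\<bar>g z - (\<Sum>i\<le>N. D i w * (z - w) ^ i / fact i)\<bar> \<le> B * \<bar>z - w\<bar> ^ Suc N"
      using D0[OF z] by simp
  qed
qed

text \<open>Since the nodes are symmetric about the midpoint, the even part of \<open>g - p\<close> is the
  interpolation error of the even part of \<open>g\<close>, whose Taylor polynomial of degree \<open>2 * r\<close> is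
  accurate to order \<open>2 * r + 2\<close>.\<close>

lemma local_interpolation_error:
  assumes "Cm (2 * r + 2) g"
  obtains C where "C > 0"
    and "\<And>n j p u. n \<ge> 1 \<Longrightarrow> j \<in> {1..n} \<Longrightarrow> degree p \<le> 2 * r \<Longrightarrow>
      (\<And>k. k \<le> 2 * r \<Longrightarrow> poly p (colloc_point r n j k) = g (colloc_point r n j k)) \<Longrightarrow> \<bar>u\<bar> \<le> 1 / 2 \<Longrightarrow>
      \<bar>g (mesh_mid n j + (1 / real n) * u) - poly p (mesh_mid n j + (1 / real n) * u)\<bar>
        \<le> C * (1 / real n) ^ (2 * r + 1)"
    and "\<And>n j p u. n \<ge> 1 \<Longrightarrow> j \<in> {1..n} \<Longrightarrow> degree p \<le> 2 * r \<Longrightarrow>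
      (\<And>k. k \<le> 2 * r \<Longrightarrow> poly p (colloc_point r n j k) = g (colloc_point r n j k)) \<Longrightarrow> \<bar>u\<bar> \<le> 1 / 2 \<Longrightarrow>
      \<bar>(g (mesh_mid n j + (1 / real n) * u) - poly p (mesh_mid n j + (1 / real n) * u)) +
       (g (mesh_mid n j - (1 / real n) * u) - poly p (mesh_mid n j - (1 / real n) * u))\<bar>
        \<le> C * (1 / real n) ^ (2 * r + 2)"
proof -
  obtain D B where "B > 0" and taylor: "\<And>N w z. N < 2 * r + 2 \<Longrightarrow> w \<in> {0..1} \<Longrightarrow> z \<in> {0..1} \<Longrightarrow>
    \<bar>g z - (\<Sum>i\<le>N. D i w * (z - w) ^ i / fact i)\<bar> \<le> B * \<bar>z - w\<bar> ^ Suc N"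
    by (rule Cm_Taylor[OF assms]) blast
  obtain \<Lambda> where "\<Lambda> > 0" and lebesgue: "\<And>q u c. degree q \<le> 2 * r \<Longrightarrow> \<bar>u\<bar> \<le> 1 / 2 \<Longrightarrow>
    (\<And>k. k \<le> 2 * r \<Longrightarrow> \<bar>poly q (ref_node r k)\<bar> \<le> c) \<Longrightarrow> \<bar>poly q u\<bar> \<le> \<Lambda> * c"
    by (rule lebesgue_constant[of r]) blast
  \<comment> \<open>\<open>1\<close> stands for the Taylor error itself and \<open>\<Lambda>\<close>
    for interpolating its nodal values; the factor 2 covers the two remainders of the mirrored
    estimate.\<close>
  define C where "C = (1 + \<Lambda>) * (2 * B)"
  have "C > 0" using \<open>B > 0\<close> \<open>\<Lambda> > 0\<close> by (simp add: C_def)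
  have main: "\<bar>g (mesh_mid n j + (1 / real n) * u) - poly p (mesh_mid n j + (1 / real n) * u)\<bar>
        \<le> C * (1 / real n) ^ (2 * r + 1) \<and>
      \<bar>(g (mesh_mid n j + (1 / real n) * u) - poly p (mesh_mid n j + (1 / real n) * u)) +
       (g (mesh_mid n j - (1 / real n) * u) - poly p (mesh_mid n j - (1 / real n) * u))\<bar>
        \<le> C * (1 / real n) ^ (2 * r + 2)"
    if n: "n \<ge> 1" and j: "j \<in> {1..n}" and deg: "degree p \<le> 2 * r"
      and nodes: "\<And>k. k \<le> 2 * r \<Longrightarrow> poly p (colloc_point r n j k) = g (colloc_point r n j k)"
      and u: "\<bar>u\<bar> \<le> 1 / 2" for n j p and u :: real
  proof -
    define m h where "m = mesh_mid n j" and "h = 1 / real n"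
    have h: "h > 0" using n by (simp add: h_def)
    have dist: "\<bar>h * v\<bar> \<le> h" if "\<bar>v\<bar> \<le> 1 / 2" for v
      using h that by (simp add: abs_mult mult_left_le)
    have interval: "mesh_interval n j = {m - 1 / 2 * h..m + 1 / 2 * h}"
      using mesh_interval_eq[of j n] j by (simp add: m_def h_def)
    have mem: "m + h * v \<in> {0..1}" if v: "\<bar>v\<bar> \<le> 1 / 2" for v
    proof -
      have "h * \<bar>v\<bar> \<le> h * (1 / 2)" using h v by (intro mult_left_mono) auto
      then have "\<bar>h * v\<bar> \<le> 1 / 2 * h" using h by (simp add: abs_mult)
      then have "m + h * v \<in> mesh_interval n j"
        unfolding interval atLeastAtMost_iff abs_le_iff by linarith
      then show ?thesis using mesh_interval_subset[OF j] by blast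
    qed
    have m: "m \<in> {0..1}" using mem[of 0] by simp
    \<comment> \<open>The Taylor polynomial about the midpoint in the reference variable, with the
      powers of \<open>h\<close> put into the coefficients.\<close>
    define T where "T = (\<Sum>i\<le>2 * r. monom (D i m * h ^ i / fact i) i)"
    have degT: "degree T \<le> 2 * r"
      unfolding T_def by (intro degree_sum_le) (auto intro: order_trans[OF degree_monom_le])
    have T: "poly T v = (\<Sum>i\<le>2 * r. D i m * (h * v) ^ i / fact i)" for v
      by (simp add: T_def poly_sum poly_monom power_mult_distrib mult_ac)
    have T_err: "\<bar>g (m + h * v) - poly T v\<bar> \<le> 2 * B * h ^ (2 * r + 1)" if v: "\<bar>v\<bar> \<le> 1 / 2" for v
    proof -
      have "\<bar>g (m + h * v) - poly T v\<bar> \<le> B * \<bar>h * v\<bar> ^ Suc (2 * r)"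
        using taylor[of "2 * r" m "m + h * v"] m mem[OF v] by (simp add: T)
      also have "\<dots> \<le> B * h ^ Suc (2 * r)"
        using \<open>B > 0\<close> dist[OF v] by (intro mult_left_mono power_mono) auto
      also have "\<dots> \<le> 2 * B * h ^ Suc (2 * r)"
        using \<open>B > 0\<close> h by simp
      finally show ?thesis by simp
    qed
    have T_err2: "\<bar>(g (m + h * v) - poly T v) + (g (m - h * v) - poly T (- v))\<bar> \<le> 2 * B * h ^ (2 * r + 2)"
      if v: "\<bar>v\<bar> \<le> 1 / 2" for v
    proof -
      \<comment> \<open>The next Taylor term has odd degree and cancels between \<open>v\<close> and
        \<open>- v\<close>; this is the source of the additional power of \<open>h\<close>.\<close>
      define a where "a = D (Suc (2 * r)) m * (h * v) ^ Suc (2 * r) / fact (Suc (2 * r))"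
      have le: "B * \<bar>h * w\<bar> ^ Suc (Suc (2 * r)) \<le> B * h ^ (2 * r + 2)" if "\<bar>w\<bar> \<le> 1 / 2" for w
        using \<open>B > 0\<close> dist[OF that] by (intro mult_left_mono) (auto simp del: power_Suc simp flip: Suc_eq_plus1 intro!: power_mono)
      have 1: "\<bar>g (m + h * v) - (poly T v + a)\<bar> \<le> B * h ^ (2 * r + 2)"
        using taylor[of "Suc (2 * r)" m "m + h * v"] m mem[OF v] le[OF v]
        by (simp add: T a_def del: power_Suc fact_Suc)
      have odd: "(h * - v) ^ Suc (2 * r) = - ((h * v) ^ Suc (2 * r))"
        by simp
      have "\<bar>g (m + h * - v) - (poly T (- v) - a)\<bar> \<le> B * h ^ (2 * r + 2)"
        using taylor[of "Suc (2 * r)" m "m + h * - v"] m mem[of "- v"] le[of "- v"] v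
        unfolding T a_def sum.atMost_Suc add_diff_cancel_left' odd by simp
      with 1 show ?thesis by (simp add: abs_le_iff)
    qed
    \<comment> \<open>Now \<open>g - p\<close> is \<open>(g - T) - q\<close>, and \<open>q\<close>
      has the small nodal values of \<open>g - T\<close>, so the Lebesgue constant controls
      it.\<close>
    define q where "q = pcompose p [:m, h:] - T"
    have q: "poly q v = poly p (m + h * v) - poly T v" for v
      by (simp add: q_def poly_pcompose mult.commute)
    have degq: "degree q \<le> 2 * r"
      unfolding q_def using deg degT h by (intro degree_diff_le) (auto simp: degree_pcompose)
    have q_node: "poly q (ref_node r k) = g (m + h * ref_node r k) - poly T (ref_node r k)"
      if "k \<le> 2 * r" for k
      using nodes[OF that] j by (simp add: q colloc_point_eq m_def h_def)
    have "\<bar>poly q u\<bar> \<le> \<Lambda> * (2 * B * h ^ (2 * r + 1))"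
      using T_err abs_ref_node_le by (intro lebesgue degq u) (simp add: q_node)
    then have fst: "\<bar>g (m + h * u) - poly p (m + h * u)\<bar> \<le> C * h ^ (2 * r + 1)"
      using T_err[OF u] by (simp add: q C_def algebra_simps abs_le_iff)
    \<comment> \<open>Twice the even part of \<open>q\<close>. Since the mirror image of node
      \<open>k\<close> is node \<open>2 * r - k\<close>, both summands are known at every
      node.\<close>
    define q2 where "q2 = q + pcompose q [:0, -1:]"
    have q2: "poly q2 v = poly q v + poly q (- v)" for v
      by (simp add: q2_def poly_pcompose)
    have "\<bar>poly q2 u\<bar> \<le> \<Lambda> * (2 * B * h ^ (2 * r + 2))"
    proof (rule lebesgue[OF _ u])
      show "degree q2 \<le> 2 * r"
        unfolding q2_def using degq by (intro degree_add_le) (auto simp: degree_pcompose)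
      fix k assume k: "k \<le> 2 * r"
      have "poly q2 (ref_node r k) = (g (m + h * ref_node r k) - poly T (ref_node r k))
          + (g (m - h * ref_node r k) - poly T (- ref_node r k))"
        using q_node[OF k] q_node[of "2 * r - k"] ref_node_reflect[OF k] by (simp add: q2)
      then show "\<bar>poly q2 (ref_node r k)\<bar> \<le> 2 * B * h ^ (2 * r + 2)"
        using T_err2[OF abs_ref_node_le[OF k]] by simp
    qed
    then have "\<bar>(g (m + h * u) - poly p (m + h * u)) + (g (m - h * u) - poly p (m - h * u))\<bar>
        \<le> C * h ^ (2 * r + 2)"
      using T_err2[OF u] by (simp add: q2 q C_def algebra_simps abs_le_iff)
    with fst show ?thesis by (simp add: m_def h_def)
  qed
  show thesis
    by (rule that[OF \<open>C > 0\<close>]) (use main in blast)+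
qed

section \<open>Cancellation under reflection of the mesh intervals\<close>

lemma has_integral_reflect_interval:
  fixes g :: "real \<Rightarrow> real"
  assumes "(g has_integral I) {a..b}" 
  shows "((\<lambda>t. g (a + b - t)) has_integral I) {a..b}"
proof -
  have "((\<lambda>t. g (- t)) has_integral I) {- b..- a}"
    using assms by (subst has_integral_reflect_real)
  from has_integral_affinity[of "\<lambda>t. g (- t)" I "- b" "- a" 1 "- (a + b)"] this
  show ?thesis by (cases "a \<le> b") (simp_all add: image_affinity_atLeastAtMost_diff add.commute)
qed

text \<open>Reflection preserves the integral, so the symmetrised integrand integrates to twice the
  original; the resulting factor 1/2 is given away.\<close>

lemma abs_integral_le_reflect:
  fixes g :: "real \<Rightarrow> real"
  assumes "g integrable_on {a..b}" and "a \<le> b"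
    and "\<And>t. t \<in> {a..b} \<Longrightarrow> \<bar>g t + g (a + b - t)\<bar> \<le> c"
  shows "\<bar>integral {a..b} g\<bar> \<le> c * (b - a)"
proof -
  have 1: "(g has_integral integral {a..b} g) {a..b}"
    using assms(1) by (rule integrable_integral)
  have "((\<lambda>t. g t + g (a + b - t)) has_integral (integral {a..b} g + integral {a..b} g)) {a..b}"
    by (intro has_integral_add 1 has_integral_reflect_interval)
  moreover have "0 \<le> c" using assms(3)[of a] assms(2) by auto
  ultimately have "norm (integral {a..b} g + integral {a..b} g) \<le> c * measure lborel {a..b}"
    using assms(3) by (intro has_integral_bound_real) auto
  moreover have "0 \<le> c * (b - a)" using \<open>0 \<le> c\<close> assms(2) by simp
  ultimately show ?thesis using assms(2) by simp
qed

context continuous_kernel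
begin

text \<open>For mirror points \<open>t\<close>, \<open>t'\<close> of an interval, the two products
  of kernel and error add up to \<open>\<kappa> s t * (E j t + E j t') + (\<kappa> s t' - \<kappa> s
  t) * E j t'\<close>. The first term is small by \<open>c2\<close>, the second by the Lipschitz
  bound times \<open>c1\<close>. Summation costs nothing, as the \<open>n\<close> intervals have
  total length 1.\<close>

lemma abs_fredholm_piecewise_le:
  assumes "n \<ge> 1" and s: "s \<in> {0..1}"
    and E: "\<And>j. continuous_on {0..1} (E j)" and EL: "piecewise n E \<in> Linf"
    and B: "\<And>t. t \<in> {0..1} \<Longrightarrow> \<bar>\<kappa> s t\<bar> \<le> B"
    and L: "\<And>t t'. t \<in> {0..1} \<Longrightarrow> t' \<in> {0..1} \<Longrightarrow> \<bar>\<kappa> s t - \<kappa> s t'\<bar> \<le> L * \<bar>t - t'\<bar>" and "0 \<le> L"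
    and c1: "\<And>j u. j \<in> {1..n} \<Longrightarrow> \<bar>u\<bar> \<le> 1 / 2 \<Longrightarrow> \<bar>E j (mesh_mid n j + (1 / real n) * u)\<bar> \<le> c1"
    and c2: "\<And>j u. j \<in> {1..n} \<Longrightarrow> \<bar>u\<bar> \<le> 1 / 2 \<Longrightarrow>
      \<bar>E j (mesh_mid n j + (1 / real n) * u) + E j (mesh_mid n j - (1 / real n) * u)\<bar> \<le> c2"
  shows "\<bar>fredholm_op \<kappa> (piecewise n E) s\<bar> \<le> B * c2 + L * (1 / real n) * c1"
proof -
  define h where "h = 1 / real n"
  have h: "h > 0" using assms(1) by (simp add: h_def)
  define c where "c = B * c2 + L * h * c1"
  let ?F = "\<lambda>t. \<kappa> s t * piecewise n E t"
  have F: "integrable unit_lebesgue ?F" by (intro integrable_kernel_mult s EL)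
  have int: "?F integrable_on {0..1}"
    using F by (intro integrable_on_lebesgue_on) auto
  have local_bound: "\<bar>integral (mesh_interval n j) ?F\<bar> \<le> c * h" if j: "j \<in> {1..n}" for j
  proof -
    let ?a = "mesh_point n (j - 1)" and ?b = "mesh_point n j" and ?m = "mesh_mid n j"
    let ?G = "\<lambda>t. \<kappa> s t * E j t"
    have sub: "{?a..?b} \<subseteq> {0..1}"
      using mesh_interval_subset[OF j] by (simp add: mesh_interval_def)
    have ab: "?a \<le> ?b" "?b - ?a = h" "?a + ?b = 2 * ?m"
      using j h by (auto simp: mesh_point_def mesh_mid_def h_def of_nat_diff field_simps)
    have "integral {?a..?b} ?F = integral {?a..?b} ?G"
    proof (rule integral_spike[of "{?a}"])
      show "?G t = ?F t" if "t \<in> {?a..?b} - {?a}" for t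
        using mesh_index_eqI[OF assms(1), of j t] j that by (simp add: piecewise_def mesh_interval_def)
    qed simp
    moreover have "\<bar>integral {?a..?b} ?G\<bar> \<le> c * (?b - ?a)"
    proof (rule abs_integral_le_reflect)
      have "continuous_on {0..1} ?G"
        by (intro continuous_intros continuous_section s E)
      then show "?G integrable_on {?a..?b}"
        using sub by (intro integrable_continuous_interval) (rule continuous_on_subset)
    next
      fix t assume t: "t \<in> {?a..?b}"
      define u where "u = real n * (t - ?m)"
      define t' where "t' = ?a + ?b - t"
      have tu: "t = ?m + (1 / real n) * u" "t' = ?m - (1 / real n) * u"
        using assms(1) ab(3) by (auto simp: u_def t'_def)
      have "\<bar>t - ?m\<bar> \<le> h / 2"
        using t ab(2,3) unfolding atLeastAtMost_iff abs_le_iff by linarith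
      then have u: "\<bar>u\<bar> \<le> 1 / 2"
      proof -
        have "real n * \<bar>t - ?m\<bar> \<le> real n * (h / 2)"
          using \<open>\<bar>t - ?m\<bar> \<le> h / 2\<close> by (rule mult_left_mono) simp
        then show ?thesis using assms(1) by (simp add: u_def h_def abs_mult)
      qed
      have mem: "t \<in> {0..1}" "t' \<in> {0..1}"
        using t sub by (auto simp: t'_def)
      have "\<bar>t' - t\<bar> \<le> h" using t ab by (auto simp: t'_def)
      then have "L * \<bar>t' - t\<bar> \<le> L * h" using \<open>0 \<le> L\<close> by (rule mult_left_mono)
      then have Lh: "\<bar>\<kappa> s t' - \<kappa> s t\<bar> \<le> L * h"
        using L[OF mem(2,1)] by linarith
      have "\<bar>\<kappa> s t * E j t + \<kappa> s t' * E j t'\<bar>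
          = \<bar>\<kappa> s t * (E j t + E j t') + (\<kappa> s t' - \<kappa> s t) * E j t'\<bar>"
        by (simp add: algebra_simps)
      also have "\<dots> \<le> \<bar>\<kappa> s t\<bar> * \<bar>E j t + E j t'\<bar> + \<bar>\<kappa> s t' - \<kappa> s t\<bar> * \<bar>E j t'\<bar>"
        by (metis abs_mult abs_triangle_ineq)
      also have "\<dots> \<le> B * c2 + (L * h) * c1"
      proof (intro add_mono mult_mono)
        show "\<bar>E j t + E j t'\<bar> \<le> c2" using c2[OF j u] by (simp add: tu)
        show "\<bar>E j t'\<bar> \<le> c1" using c1[OF j, of "- u"] u by (simp add: tu)
        show "0 \<le> B" using B[OF mem(1)] by simp
        show "0 \<le> L * h" using Lh by simp
      qed (use B[OF mem(1)] Lh in auto)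
      finally show "\<bar>?G t + ?G (?a + ?b - t)\<bar> \<le> c" by (simp add: c_def t'_def)
    qed fact
    ultimately show ?thesis unfolding mesh_interval_def ab(2) by simp
  qed
  have "\<bar>integral {0..mesh_point n j} ?F\<bar> \<le> real j * (c * h)" if "j \<le> n" for j
    using that
  proof (induction j)
    case 0
    then show ?case by (simp add: mesh_point_def)
  next
    case (Suc j)
    have le: "0 \<le> mesh_point n j" "mesh_point n j \<le> mesh_point n (Suc j)" "mesh_point n (Suc j) \<le> 1"
      using Suc.prems assms(1) by (auto simp: mesh_point_def divide_right_mono)
    have "?F integrable_on {0..mesh_point n (Suc j)}"
      using le by (intro integrable_subinterval_real[OF int]) auto
    from Henstock_Kurzweil_Integration.integral_combine[OF le(1,2) this]
    have "integral {0..mesh_point n (Suc j)} ?F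
        = integral {0..mesh_point n j} ?F + integral (mesh_interval n (Suc j)) ?F"
      by (simp add: mesh_interval_def)
    also have "\<bar>\<dots>\<bar> \<le> real j * (c * h) + c * h"
      using Suc local_bound[of "Suc j"] by (intro order_trans[OF abs_triangle_ineq] add_mono) auto
    finally show ?case by (simp add: algebra_simps)
  qed
  from this[of n] have "\<bar>integral {0..1} ?F\<bar> \<le> c"
    using assms(1) by (simp add: mesh_point_def h_def)
  moreover have "fredholm_op \<kappa> (piecewise n E) s = integral {0..1} ?F"
    unfolding fredholm_op_def using F by (intro lebesgue_integral_eq_integral) auto
  ultimately show ?thesis by (simp add: c_def h_def)
qed

end

section \<open>Lipschitz continuity of the kernel in its second argument\<close>

lemma continuous_partials_on_Lipschitz_snd:
  assumes g: "continuous_partials_on \<Omega> J g" and J: "(0, Suc 0) \<in> J"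
    and "compact \<Omega>" and conv: "\<And>s. convex {v. (s, v) \<in> \<Omega>}"
  obtains L where "L \<ge> 0"
    and "\<And>s t t'. (s, t) \<in> \<Omega> \<Longrightarrow> (s, t') \<in> \<Omega> \<Longrightarrow> \<bar>g s t - g s t'\<bar> \<le> L * \<bar>t - t'\<bar>"
proof -
  obtain D where D0: "\<And>s t. (s, t) \<in> \<Omega> \<Longrightarrow> D 0 0 s t = g s t"
    and D: "\<And>s t. (s, t) \<in> \<Omega> \<Longrightarrow>
      ((\<lambda>v. D 0 0 s v) has_real_derivative D 0 (Suc 0) s t) (at t within {v. (s, v) \<in> \<Omega>})"
    and cont: "continuous_on \<Omega> (\<lambda>(s, t). D 0 (Suc 0) s t)"
    using g J unfolding continuous_partials_on_def by fast
  from compact_imp_bounded[OF compact_continuous_image[OF cont \<open>compact \<Omega>\<close>]]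
  obtain L where L: "L > 0" "\<And>s t. (s, t) \<in> \<Omega> \<Longrightarrow> norm (D 0 (Suc 0) s t) \<le> L"
    by (force simp: bounded_pos)
  show thesis
  proof (rule that)
    show "L \<ge> 0" using L(1) by simp
    fix s t t' assume t: "(s, t) \<in> \<Omega>" "(s, t') \<in> \<Omega>"
    \<comment> \<open>Mean value inequality on a convex section; compactness of the domain makes the
      derivative bound independent of \<open>s\<close>.\<close>
    have "norm (D 0 0 s t - D 0 0 s t') \<le> L * norm (t - t')"
      using t D L(2) by (intro field_differentiable_bound[OF conv]) auto
    then show "\<bar>g s t - g s t'\<bar> \<le> L * \<bar>t - t'\<bar>"
      using D0 t by simp
  qed
qed

lemma compact_Omega: "compact Omega1" "compact Omega2"
proof -
  have 1: "Omega1 = ({0..1} \<times> {0..1}) \<inter> {z. snd z \<le> fst z}"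
    and 2: "Omega2 = ({0..1} \<times> {0..1}) \<inter> {z. fst z \<le> snd z}"
    by (auto simp: Omega1_def Omega2_def)
  show "compact Omega1"
    unfolding 1 by (intro compact_Int_closed compact_Times closed_Collect_le continuous_intros) auto
  show "compact Omega2"
    unfolding 2 by (intro compact_Int_closed compact_Times closed_Collect_le continuous_intros) auto
qed

text \<open>When \<open>s\<close> lies between \<open>t\<close> and \<open>t'\<close>, the increment
  is split at the diagonal point \<open>(s, s)\<close>, which belongs to both triangles. The two
  lengths add up to the distance of \<open>t\<close> and \<open>t'\<close>, so the larger of the two
  constants suffices despite a possible jump of the derivative.\<close>

lemma green_type_kernel_Lipschitz:
  assumes "green_type_kernel \<alpha> \<kappa>" and "\<alpha> \<ge> 1"
  obtains L where "L \<ge> 0" and "\<And>s t t'. s \<in> {0..1} \<Longrightarrow> t \<in> {0..1} \<Longrightarrow> t' \<in> {0..1} \<Longrightarrow>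
    \<bar>\<kappa> s t - \<kappa> s t'\<bar> \<le> L * \<bar>t - t'\<bar>"
proof -
  obtain \<kappa>1 \<kappa>2 where k1: "continuous_partials_on Omega1 {(j, k). j + k \<le> \<alpha>} \<kappa>1"
    and k2: "continuous_partials_on Omega2 {(j, k). j + k \<le> \<alpha>} \<kappa>2"
    and eq1: "\<And>s t. (s, t) \<in> Omega1 \<Longrightarrow> \<kappa> s t = \<kappa>1 s t"
    and eq2: "\<And>s t. (s, t) \<in> Omega2 \<Longrightarrow> \<kappa> s t = \<kappa>2 s t"
    using assms(1) unfolding green_type_kernel_def by fast
  have conv: "convex {v. (s, v) \<in> Omega1}" "convex {v. (s, v) \<in> Omega2}" for s
  proof -
    have "{v. (s, v) \<in> Omega1} = (if s \<le> 1 then {0..s} else {})"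
      "{v. (s, v) \<in> Omega2} = (if 0 \<le> s then {s..1} else {})"
      by (auto simp: Omega1_def Omega2_def)
    then show "convex {v. (s, v) \<in> Omega1}" "convex {v. (s, v) \<in> Omega2}" by auto
  qed
  obtain L1 where L1: "L1 \<ge> 0" "\<And>s t t'. (s, t) \<in> Omega1 \<Longrightarrow> (s, t') \<in> Omega1 \<Longrightarrow> \<bar>\<kappa>1 s t - \<kappa>1 s t'\<bar> \<le> L1 * \<bar>t - t'\<bar>"
    by (rule continuous_partials_on_Lipschitz_snd[OF k1 _ compact_Omega(1) conv(1)]) (use assms(2) in auto)
  obtain L2 where L2: "L2 \<ge> 0" "\<And>s t t'. (s, t) \<in> Omega2 \<Longrightarrow> (s, t') \<in> Omega2 \<Longrightarrow> \<bar>\<kappa>2 s t - \<kappa>2 s t'\<bar> \<le> L2 * \<bar>t - t'\<bar>"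
    by (rule continuous_partials_on_Lipschitz_snd[OF k2 _ compact_Omega(2) conv(2)]) (use assms(2) in auto)
  define L where "L = max L1 L2"
  have lower: "\<bar>\<kappa> s t - \<kappa> s t'\<bar> \<le> L * \<bar>t - t'\<bar>" if "(s, t) \<in> Omega1" "(s, t') \<in> Omega1" for s t t'
    using L1(2)[OF that] eq1[OF that(1)] eq1[OF that(2)] mult_right_mono[of L1 L "\<bar>t - t'\<bar>"]
    by (simp add: L_def)
  have upper: "\<bar>\<kappa> s t - \<kappa> s t'\<bar> \<le> L * \<bar>t - t'\<bar>" if "(s, t) \<in> Omega2" "(s, t') \<in> Omega2" for s t t'
    using L2(2)[OF that] eq2[OF that(1)] eq2[OF that(2)] mult_right_mono[of L2 L "\<bar>t - t'\<bar>"]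
    by (simp add: L_def)
  have across: "\<bar>\<kappa> s t - \<kappa> s t'\<bar> \<le> L * \<bar>t - t'\<bar>" if "s \<in> {0..1}" "t \<in> {0..1}" "t' \<in> {0..1}" "t \<le> t'" for s t t'
  proof -
    consider "t' \<le> s" | "s \<le> t" | "t \<le> s" "s \<le> t'" by linarith
    then show ?thesis
    proof cases
      case 3
      have "\<bar>\<kappa> s t - \<kappa> s s\<bar> \<le> L * \<bar>t - s\<bar>" "\<bar>\<kappa> s s - \<kappa> s t'\<bar> \<le> L * \<bar>s - t'\<bar>"
        using lower[of s t s] upper[of s s t'] that 3 by (auto simp: Omega1_def Omega2_def)
      moreover have "\<bar>t - t'\<bar> = \<bar>t - s\<bar> + \<bar>s - t'\<bar>" using 3 by simp
      ultimately show ?thesis by (simp only: distrib_left) linarith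
    qed (use that lower[of s t t'] upper[of s t t'] in \<open>auto simp: Omega1_def Omega2_def\<close>)
  qed
  show thesis
  proof (rule that)
    show "L \<ge> 0" using L1(1) by (simp add: L_def)
    show "\<bar>\<kappa> s t - \<kappa> s t'\<bar> \<le> L * \<bar>t - t'\<bar>" if "s \<in> {0..1}" "t \<in> {0..1}" "t' \<in> {0..1}" for s t t'
      using across[of s t t'] across[of s t' t] that by (cases "t \<le> t'") (auto simp: abs_minus_commute)
  qed
qed

lemma collocation_solution_Linf: "collocation_solution \<kappa> f Pn x \<Longrightarrow> x \<in> Linf"
  by (simp add: collocation_solution_def)

lemma (in continuous_kernel) fredholm_Linf: "x \<in> Linf \<Longrightarrow> fredholm_op \<kappa> x \<in> Linf"
  by (rule continuous_imp_Linf[OF continuous_fredholm])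

context collocation
begin

text \<open>\<open>P n g\<close> is known only almost everywhere, but the integral operator ignores
  null sets, so the explicit representative \<open>piecewise n E\<close> can replace
  \<open>g - P n g\<close>. The order \<open>2 * r + 2\<close> results from \<open>c2\<close>
  directly and from \<open>c1\<close> times one Lipschitz factor \<open>1 / real n\<close>.\<close>

lemma projection_error:
  assumes g: "Cm (2 * r + 2) g"
    and L: "L \<ge> 0" "\<And>s t t'. s \<in> {0..1} \<Longrightarrow> t \<in> {0..1} \<Longrightarrow> t' \<in> {0..1} \<Longrightarrow>
      \<bar>\<kappa> s t - \<kappa> s t'\<bar> \<le> L * \<bar>t - t'\<bar>"
  obtains C where "C > 0"
    and "\<And>n. n \<ge> 1 \<Longrightarrow> AE t in unit_lebesgue. \<bar>g t - P n g t\<bar> \<le> C * (1 / real n) ^ (2 * r + 1)"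
    and "\<And>n s. n \<ge> 1 \<Longrightarrow> s \<in> {0..1} \<Longrightarrow>
      \<bar>fredholm_op \<kappa> (\<lambda>t. g t - P n g t) s\<bar> \<le> C * (1 / real n) ^ (2 * r + 2)"
proof -
  obtain C where C: "C > 0"
    and C1: "\<And>n j p u. n \<ge> 1 \<Longrightarrow> j \<in> {1..n} \<Longrightarrow> degree p \<le> 2 * r \<Longrightarrow>
      (\<And>k. k \<le> 2 * r \<Longrightarrow> poly p (colloc_point r n j k) = g (colloc_point r n j k)) \<Longrightarrow> \<bar>u\<bar> \<le> 1 / 2 \<Longrightarrow>
      \<bar>g (mesh_mid n j + (1 / real n) * u) - poly p (mesh_mid n j + (1 / real n) * u)\<bar>
        \<le> C * (1 / real n) ^ (2 * r + 1)"
    and C2: "\<And>n j p u. n \<ge> 1 \<Longrightarrow> j \<in> {1..n} \<Longrightarrow> degree p \<le> 2 * r \<Longrightarrow>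
      (\<And>k. k \<le> 2 * r \<Longrightarrow> poly p (colloc_point r n j k) = g (colloc_point r n j k)) \<Longrightarrow> \<bar>u\<bar> \<le> 1 / 2 \<Longrightarrow>
      \<bar>(g (mesh_mid n j + (1 / real n) * u) - poly p (mesh_mid n j + (1 / real n) * u)) +
       (g (mesh_mid n j - (1 / real n) * u) - poly p (mesh_mid n j - (1 / real n) * u))\<bar>
        \<le> C * (1 / real n) ^ (2 * r + 2)"
    by (rule local_interpolation_error[OF g]) blast
  obtain B where B: "B > 0" "\<And>s t. s \<in> {0..1} \<Longrightarrow> t \<in> {0..1} \<Longrightarrow> \<bar>\<kappa> s t\<bar> \<le> B"
    by (rule bounded) blast
  have gc: "continuous_on {0..1} g" by (rule Cm_continuous[OF g])
  have main: "(AE t in unit_lebesgue. \<bar>g t - P n g t\<bar> \<le> C * (1 / real n) ^ (2 * r + 1)) \<and>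
      (\<forall>s\<in>{0..1}. \<bar>fredholm_op \<kappa> (\<lambda>t. g t - P n g t) s\<bar> \<le> (B + L) * C * (1 / real n) ^ (2 * r + 2))"
    if n: "n \<ge> 1" for n
  proof -
    obtain p where deg: "\<And>j. degree (p j) \<le> 2 * r"
      and nodes: "\<And>j k. j \<in> {1..n} \<Longrightarrow> k \<in> {0..2 * r} \<Longrightarrow>
             poly (p j) (colloc_point r n j k) = g (colloc_point r n j k)"
      and ae: "AE t in unit_lebesgue. P n g t = piecewise n (\<lambda>j. poly (p j)) t"
      by (rule is_pp_interpolantE[OF interpolant[OF n gc] n]) blast
    define E where "E j t = g t - poly (p j) t" for j t
    have Ec: "continuous_on {0..1} (E j)" for j
      unfolding E_def[abs_def] by (intro continuous_intros gc)
    have ae': "AE t in unit_lebesgue. g t - P n g t = piecewise n E t"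
      using ae by eventually_elim (simp add: E_def piecewise_def)
    have c1: "\<bar>E j (mesh_mid n j + (1 / real n) * u)\<bar> \<le> C * (1 / real n) ^ (2 * r + 1)"
      and c2: "\<bar>E j (mesh_mid n j + (1 / real n) * u) + E j (mesh_mid n j - (1 / real n) * u)\<bar>
        \<le> C * (1 / real n) ^ (2 * r + 2)"
      if "j \<in> {1..n}" "\<bar>u\<bar> \<le> 1 / 2" for j u
      unfolding E_def using nodes[OF that(1)]
      by (intro C1[OF n that(1) deg _ that(2)] C2[OF n that(1) deg _ that(2)]; simp)+
    have le: "AE t in unit_lebesgue. \<bar>piecewise n E t\<bar> \<le> C * (1 / real n) ^ (2 * r + 1)"
      using AE_unit_neq[of 0] AE_space
    proof eventually_elim
      case (elim t)
      then have t: "t \<in> {0<..1}" by auto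
      define j where "j = mesh_index n t"
      have j: "j \<in> {1..n}" "t \<in> mesh_interval n j"
        using mesh_index_works[OF n t] by (simp_all add: j_def)
      then have j1: "j \<ge> 1" by simp
      define u where "u = real n * (t - mesh_mid n j)"
      have "\<bar>t - mesh_mid n j\<bar> \<le> 1 / 2 * (1 / real n)"
        using j(2) unfolding mesh_interval_eq[OF j1] atLeastAtMost_iff abs_le_iff by linarith
      then have "real n * \<bar>t - mesh_mid n j\<bar> \<le> real n * (1 / 2 * (1 / real n))"
        by (rule mult_left_mono) simp
      then have u: "\<bar>u\<bar> \<le> 1 / 2" using n by (simp add: u_def abs_mult)
      have "mesh_mid n j + (1 / real n) * u = t" using n by (simp add: u_def)
      with c1[OF j(1) u] show ?case by (simp only: piecewise_def j_def)
    qed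
    have EL: "piecewise n E \<in> Linf"
      by (rule LinfI[OF piecewise_measurable le]) (rule continuous_measurable_unit[OF Ec])
    have "\<bar>fredholm_op \<kappa> (\<lambda>t. g t - P n g t) s\<bar> \<le> (B + L) * C * (1 / real n) ^ (2 * r + 2)"
      if s: "s \<in> {0..1}" for s
    proof -
      have "fredholm_op \<kappa> (\<lambda>t. g t - P n g t) s = fredholm_op \<kappa> (piecewise n E) s"
        by (intro fredholm_cong_AE s EL ae' Linf_diff P_Linf n continuous_imp_Linf[OF gc])
      also have "\<bar>\<dots>\<bar> \<le> B * (C * (1 / real n) ^ (2 * r + 2)) + L * (1 / real n) * (C * (1 / real n) ^ (2 * r + 1))"
        by (rule abs_fredholm_piecewise_le[OF n s Ec EL B(2)[OF s] L(2)[OF s] L(1) c1 c2])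
      also have "\<dots> = (B + L) * C * (1 / real n) ^ (2 * r + 2)"
        by (simp add: algebra_simps add_divide_distrib)
      finally show ?thesis .
    qed
    moreover have "AE t in unit_lebesgue. \<bar>g t - P n g t\<bar> \<le> C * (1 / real n) ^ (2 * r + 1)"
      using ae' le by eventually_elim simp
    ultimately show ?thesis by blast
  qed
  define C' where "C' = max C ((B + L) * C)"
  show thesis
  proof (rule that)
    show "C' > 0" using C by (simp add: C'_def)
    show "AE t in unit_lebesgue. \<bar>g t - P n g t\<bar> \<le> C' * (1 / real n) ^ (2 * r + 1)" if "n \<ge> 1" for n
    proof -
      have "C * (1 / real n) ^ (2 * r + 1) \<le> C' * (1 / real n) ^ (2 * r + 1)"
        by (intro mult_right_mono) (auto simp: C'_def)
      with main[OF that] show ?thesis by (auto elim!: eventually_mono)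
    qed
    show "\<bar>fredholm_op \<kappa> (\<lambda>t. g t - P n g t) s\<bar> \<le> C' * (1 / real n) ^ (2 * r + 2)"
      if "n \<ge> 1" "s \<in> {0..1}" for n s
    proof -
      have "(B + L) * C * (1 / real n) ^ (2 * r + 2) \<le> C' * (1 / real n) ^ (2 * r + 2)"
        by (intro mult_right_mono) (auto simp: C'_def)
      with main[OF that(1)] that(2) show ?thesis by fastforce
    qed
  qed
qed

context
  fixes n :: nat and f \<phi> x :: "real \<Rightarrow> real" and C :: real
  assumes n: "n \<ge> 1" and C: "C > 0"
    and stable: "\<And>x. x \<in> Linf \<Longrightarrow> Linf_norm x \<le> C * Linf_norm (\<lambda>t. x t - P n (fredholm_op \<kappa> x) t)"
    and f: "continuous_on {0..1} f" and \<phi>: "continuous_on {0..1} \<phi>"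
    and eq: "\<And>s. s \<in> {0..1} \<Longrightarrow> \<phi> s - fredholm_op \<kappa> \<phi> s = f s"
    and sol: "collocation_solution \<kappa> f (P n) x"
begin

text \<open>Applying \<open>P n\<close> to the integral equation shows that the residual of
  \<open>\<phi>\<close> is \<open>\<phi> - P n \<phi> + P n f\<close>, while that of
  \<open>x\<close> is \<open>P n f\<close>.\<close>

lemma AE_error_residual:
  "AE t in unit_lebesgue. (\<phi> t - x t) - P n (fredholm_op \<kappa> (\<lambda>t. \<phi> t - x t)) t = \<phi> t - P n \<phi> t"
proof -
  \<comment> \<open>The factors 1 match the form of \<open>P_lincomb\<close>.\<close>
  have "AE t in unit_lebesgue. 1 * fredholm_op \<kappa> \<phi> t + 1 * f t = \<phi> t"
  proof (rule AE_I2)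
    fix t assume "t \<in> space unit_lebesgue"
    with eq[of t] show "1 * fredholm_op \<kappa> \<phi> t + 1 * f t = \<phi> t" by simp
  qed
  from P_cong_AE[OF n Linf_lincomb[OF fredholm_Linf[OF continuous_imp_Linf[OF \<phi>]] continuous_imp_Linf[OF f]] continuous_imp_Linf[OF \<phi>] this]
    P_lincomb[OF n fredholm_Linf[OF continuous_imp_Linf[OF \<phi>]] continuous_imp_Linf[OF f], of 1 1]
    AE_residual_diff[OF n continuous_imp_Linf[OF \<phi>] collocation_solution_Linf[OF sol]] sol[unfolded collocation_solution_def, THEN conjunct2]
  show ?thesis by eventually_elim simp
qed

lemma collocation_error:
  assumes "AE t in unit_lebesgue. \<bar>\<phi> t - P n \<phi> t\<bar> \<le> a"
  shows "Linf_norm (\<lambda>t. \<phi> t - x t) \<le> C * a"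
proof -
  let ?w = "\<lambda>t. \<phi> t - x t"
  have w: "?w \<in> Linf" by (rule Linf_diff[OF continuous_imp_Linf[OF \<phi>] collocation_solution_Linf[OF sol]])
  have "Linf_norm (\<lambda>t. ?w t - P n (fredholm_op \<kappa> ?w) t) \<le> a"
  proof (rule Linf_norm_le)
    show "(\<lambda>t. ?w t - P n (fredholm_op \<kappa> ?w) t) \<in> borel_measurable unit_lebesgue"
      by (rule Linf_measurable[OF Linf_diff[OF w P_Linf[OF n fredholm_Linf[OF w]]]])
    show "AE t in unit_lebesgue. \<bar>?w t - P n (fredholm_op \<kappa> ?w) t\<bar> \<le> a"
      using AE_error_residual assms by eventually_elim simp
  qed
  then have "C * Linf_norm (\<lambda>t. ?w t - P n (fredholm_op \<kappa> ?w) t) \<le> C * a"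
    using C by simp
  with stable[OF w] show ?thesis by linarith
qed

text \<open>With \<open>w = \<phi> - x\<close> and \<open>u = P n (K w)\<close> one has \<open>w = (\<phi> - P n \<phi>) + u\<close>, and the residual of
  \<open>u\<close> is \<open>P n (K (\<phi> - P n \<phi>))\<close>; so stability bounds \<open>K w\<close> by the norm of \<open>K (\<phi> - P n \<phi>)\<close>.\<close>

lemma iterated_collocation_error:
  assumes M: "M > 0" "\<And>y. y \<in> Linf \<Longrightarrow> Linf_norm (P n y) \<le> M * Linf_norm y"
    and B: "\<And>s t. s \<in> {0..1} \<Longrightarrow> t \<in> {0..1} \<Longrightarrow> \<bar>\<kappa> s t\<bar> \<le> B"
    and a: "\<And>s. s \<in> {0..1} \<Longrightarrow> \<bar>fredholm_op \<kappa> (\<lambda>t. \<phi> t - P n \<phi> t) s\<bar> \<le> a"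
  shows "Linf_norm (\<lambda>s. \<phi> s - iterated_collocation \<kappa> f x s) \<le> (1 + B * (C * M)) * a"
proof -
  define w v where "w = (\<lambda>t. \<phi> t - x t)" and "v = (\<lambda>t. \<phi> t - P n \<phi> t)"
  \<comment> \<open>Almost everywhere \<open>u\<close> is \<open>P n \<phi> - x\<close>. Bounding
    the image of \<open>w\<close> by the norm of \<open>w\<close> would give only order
    \<open>2 * r + 1\<close>; in contrast, \<open>u\<close> is already as small as the image of
    \<open>v\<close>.\<close>
  define u where "u = P n (fredholm_op \<kappa> w)"
  have w: "w \<in> Linf" and v: "v \<in> Linf"
    unfolding w_def v_def by (intro Linf_diff continuous_imp_Linf[OF \<phi>] collocation_solution_Linf[OF sol] P_Linf n)+
  have u: "u \<in> Linf" unfolding u_def by (intro P_Linf n fredholm_Linf w)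
  have w_eq: "AE t in unit_lebesgue. w t = v t + u t"
    using AE_error_residual unfolding w_def[symmetric] u_def
    by eventually_elim (simp add: v_def w_def)
  have Kw: "fredholm_op \<kappa> w s = fredholm_op \<kappa> v s + fredholm_op \<kappa> u s" if "s \<in> {0..1}" for s
    using fredholm_cong_AE[OF that w Linf_add[OF v u] w_eq] fredholm_lincomb[OF that v u, of 1 1] by simp
  have "AE t in unit_lebesgue. P n (\<lambda>t. fredholm_op \<kappa> w t - fredholm_op \<kappa> u t) t = P n (fredholm_op \<kappa> v) t"
    using Kw by (intro P_cong_AE n Linf_diff fredholm_Linf w u v AE_I2) auto
  moreover have "AE t in unit_lebesgue. P n (\<lambda>t. fredholm_op \<kappa> w t - fredholm_op \<kappa> u t) t
      = P n (fredholm_op \<kappa> w) t - P n (fredholm_op \<kappa> u) t"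
    by (intro P_diff n fredholm_Linf w u)
  ultimately have "AE t in unit_lebesgue. \<bar>u t - P n (fredholm_op \<kappa> u) t\<bar> \<le> \<bar>P n (fredholm_op \<kappa> v) t\<bar>"
    by eventually_elim (simp add: u_def)
  then have "Linf_norm (\<lambda>t. u t - P n (fredholm_op \<kappa> u) t) \<le> Linf_norm (P n (fredholm_op \<kappa> v))"
    by (intro Linf_norm_mono Linf_diff u P_Linf n fredholm_Linf v)
  also have "\<dots> \<le> M * Linf_norm (fredholm_op \<kappa> v)"
    by (intro M fredholm_Linf v)
  also have "\<dots> \<le> M * a"
    using M(1) a unfolding v_def[symmetric]
    by (intro mult_left_mono Linf_norm_le_everywhere Linf_measurable fredholm_Linf v) auto
  finally have "C * Linf_norm (\<lambda>t. u t - P n (fredholm_op \<kappa> u) t) \<le> C * (M * a)"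
    using C by simp
  with stable[OF u] have u_le: "Linf_norm u \<le> C * (M * a)" by linarith
  have ae_u: "AE t in unit_lebesgue. \<bar>u t\<bar> \<le> C * (M * a)"
    using AE_Linf_norm[OF u] u_le by (auto elim!: eventually_mono)
  show ?thesis
  proof (rule Linf_norm_le_everywhere)
    show "(\<lambda>s. \<phi> s - iterated_collocation \<kappa> f x s) \<in> borel_measurable unit_lebesgue"
      unfolding iterated_collocation_def
      by (intro Linf_measurable Linf_diff Linf_add continuous_imp_Linf[OF \<phi>] fredholm_Linf collocation_solution_Linf[OF sol] continuous_imp_Linf[OF f])
    fix s :: real assume s: "s \<in> {0..1}"
    have "\<phi> s - iterated_collocation \<kappa> f x s = fredholm_op \<kappa> w s"
      using eq[OF s] fredholm_lincomb[OF s continuous_imp_Linf[OF \<phi>] collocation_solution_Linf[OF sol], of 1 "-1"]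
      by (simp add: iterated_collocation_def w_def)
    also have "\<bar>\<dots>\<bar> \<le> \<bar>fredholm_op \<kappa> v s\<bar> + \<bar>fredholm_op \<kappa> u s\<bar>"
      unfolding Kw[OF s] by (rule abs_triangle_ineq)
    \<comment> \<open>\<open>a\<close> bounds the image of \<open>v\<close>; for \<open>u\<close>
      the factors are the kernel bound, the stability constant and the projection norm.\<close>
    also have "\<dots> \<le> a + B * (C * (M * a))"
      using a[OF s] by (intro add_mono abs_fredholm_le s u ae_u B) (simp_all add: v_def)
    also have "\<dots> = (1 + B * (C * M)) * a" by (simp add: algebra_simps)
    finally show "\<bar>\<phi> s - iterated_collocation \<kappa> f x s\<bar> \<le> (1 + B * (C * M)) * a" .
  qed
qed

end

end

text \<open>Solutions are unique only up to null sets and are guaranteed only for large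
  \<open>n\<close>. The rates are therefore claimed for every sequence \<open>\<phi>C\<close> that
  eventually consists of solutions.\<close>

theorem theorem4:
  fixes r \<alpha> :: nat
    and \<kappa> :: "real \<Rightarrow> real \<Rightarrow> real"
    and f \<phi> :: "real \<Rightarrow> real"
    and P :: "nat \<Rightarrow> (real \<Rightarrow> real) \<Rightarrow> real \<Rightarrow> real"
  assumes "\<alpha> \<ge> 1" and "r \<ge> 1 \<Longrightarrow> \<alpha> > r"
    and "green_type_kernel \<alpha> \<kappa>"
    and "\<not> fredholm_eigenvalue \<kappa> 1"
    and "continuous_on {0..1} f"
    and "\<forall>s\<in>{0..1}. \<phi> s - fredholm_op \<kappa> \<phi> s = f s"
    and "Cm (2 * r + 2) \<phi>"
    and "interpolatory_projections r P"
  shows "(\<forall>\<^sub>F n in sequentially. \<exists>x. collocation_solution \<kappa> f (P n) x \<and>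
            (\<forall>y. collocation_solution \<kappa> f (P n) y \<longrightarrow> (AE t in unit_lebesgue. y t = x t)))
       \<and> (\<forall>\<phi>C :: nat \<Rightarrow> real \<Rightarrow> real.
            (\<forall>\<^sub>F n in sequentially. collocation_solution \<kappa> f (P n) (\<phi>C n)) \<longrightarrow>
            (\<lambda>n. Linf_norm (\<lambda>s. \<phi> s - \<phi>C n s)) \<in> O(\<lambda>n. (1 / real n) ^ (2 * r + 1)) \<and>
            (\<lambda>n. Linf_norm (\<lambda>s. \<phi> s - iterated_collocation \<kappa> f (\<phi>C n) s))
              \<in> O(\<lambda>n. (1 / real n) ^ (2 * r + 2)))"
proof -
  interpret collocation \<kappa> r P
    by unfold_locales (use assms(3,8) in \<open>auto simp: green_type_kernel_def\<close>)
  note \<phi> = Cm_continuous[OF assms(7)]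
  have eq: "\<And>s. s \<in> {0..1} \<Longrightarrow> \<phi> s - fredholm_op \<kappa> \<phi> s = f s"
    using assms(6) by blast
  obtain C N where C: "C > 0" and N: "N \<ge> 1" and stable: "\<And>n x. n \<ge> N \<Longrightarrow> x \<in> Linf \<Longrightarrow>
    Linf_norm x \<le> C * Linf_norm (\<lambda>t. x t - P n (fredholm_op \<kappa> x) t)"
    by (rule stability[OF assms(4)]) blast
  obtain L where L: "L \<ge> 0" "\<And>s t t'. s \<in> {0..1} \<Longrightarrow> t \<in> {0..1} \<Longrightarrow> t' \<in> {0..1} \<Longrightarrow>
    \<bar>\<kappa> s t - \<kappa> s t'\<bar> \<le> L * \<bar>t - t'\<bar>"
    by (rule green_type_kernel_Lipschitz[OF assms(3,1)]) blast
  obtain D where D: "D > 0"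
    and D1: "\<And>n. n \<ge> 1 \<Longrightarrow> AE t in unit_lebesgue. \<bar>\<phi> t - P n \<phi> t\<bar> \<le> D * (1 / real n) ^ (2 * r + 1)"
    and D2: "\<And>n s. n \<ge> 1 \<Longrightarrow> s \<in> {0..1} \<Longrightarrow>
      \<bar>fredholm_op \<kappa> (\<lambda>t. \<phi> t - P n \<phi> t) s\<bar> \<le> D * (1 / real n) ^ (2 * r + 2)"
    by (rule projection_error[OF assms(7) L]) blast+
  obtain B where B: "B > 0" "\<And>s t. s \<in> {0..1} \<Longrightarrow> t \<in> {0..1} \<Longrightarrow> \<bar>\<kappa> s t\<bar> \<le> B"
    by (rule bounded) blast
  obtain M where M: "M > 0" "\<And>n x. n \<ge> 1 \<Longrightarrow> x \<in> Linf \<Longrightarrow> Linf_norm (P n x) \<le> M * Linf_norm x"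
    by (rule P_bounded) blast
  have large: "\<forall>\<^sub>F n in sequentially. n \<ge> N" by (rule eventually_ge_at_top)
  have "\<forall>\<^sub>F n in sequentially. \<exists>x. collocation_solution \<kappa> f (P n) x \<and>
      (\<forall>y. collocation_solution \<kappa> f (P n) y \<longrightarrow> (AE t in unit_lebesgue. y t = x t))"
    using large
  proof eventually_elim
    case (elim n)
    then have n: "n \<ge> 1" using N by simp
    obtain x where x: "collocation_solution \<kappa> f (P n) x"
      using collocation_solution_exists[OF n assms(5) stable[OF elim]] by blast
    with collocation_solution_unique[OF n stable[OF elim] x] show ?case by blast
  qed
  moreover have "(\<lambda>n. Linf_norm (\<lambda>s. \<phi> s - \<phi>C n s)) \<in> O(\<lambda>n. (1 / real n) ^ (2 * r + 1)) \<and>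
      (\<lambda>n. Linf_norm (\<lambda>s. \<phi> s - iterated_collocation \<kappa> f (\<phi>C n) s))
        \<in> O(\<lambda>n. (1 / real n) ^ (2 * r + 2))"
    if ev: "\<forall>\<^sub>F n in sequentially. collocation_solution \<kappa> f (P n) (\<phi>C n)" for \<phi>C
  proof (intro conjI bigoI)
    show "\<forall>\<^sub>F n in sequentially. norm (Linf_norm (\<lambda>s. \<phi> s - \<phi>C n s))
        \<le> (C * D) * norm ((1 / real n) ^ (2 * r + 1))"
      using ev large
    proof eventually_elim
      case (elim n)
      then have n: "n \<ge> 1" using N by simp
      have "0 \<le> Linf_norm (\<lambda>s. \<phi> s - \<phi>C n s)"
        by (rule Linf_norm_nonneg[OF Linf_diff[OF continuous_imp_Linf[OF \<phi>]
                collocation_solution_Linf[OF elim(1)]]])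
      then show ?case
        using collocation_error[OF n C stable[OF elim(2)] assms(5) \<phi> eq elim(1) D1[OF n]]
        by (simp add: mult.assoc)
    qed
    show "\<forall>\<^sub>F n in sequentially. norm (Linf_norm (\<lambda>s. \<phi> s - iterated_collocation \<kappa> f (\<phi>C n) s))
        \<le> ((1 + B * (C * M)) * D) * norm ((1 / real n) ^ (2 * r + 2))"
      using ev large
    proof eventually_elim
      case (elim n)
      then have n: "n \<ge> 1" using N by simp
      have "0 \<le> Linf_norm (\<lambda>s. \<phi> s - iterated_collocation \<kappa> f (\<phi>C n) s)"
        unfolding iterated_collocation_def
        by (intro Linf_norm_nonneg continuous_imp_Linf continuous_intros \<phi> assms(5)
            continuous_fredholm[OF collocation_solution_Linf[OF elim(1)]])
      then show ?case
        using iterated_collocation_error[OF n C stable[OF elim(2)] assms(5) \<phi> eq elim(1) M(1) M(2)[OF n] B(2) D2[OF n]]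
        by (simp add: mult.assoc)
    qed
  qed
  ultimately show ?thesis by blast
qed

end
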